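(* Let $\epsilon>0$ and $\gamma>0$ be sufficiently small, let $|\phi_0|$ be sufficiently small, and let $T=\frac{8C_n}{\kappa_n\epsilon}$. Consider the system for $x=(s,\delta,\zeta)$ (with $s,\delta\in\mathbb R$, $\zeta\in\mathbb R^{2n}$) $$\dot s=\mathcal O(\delta+\gamma\epsilon^n)\|\zeta\|+\mathcal O(\|\zeta\|^2),$$ $$\dot\delta=-(2+\mathcal O(\delta))\gamma\epsilon^{2n-1}+\mathcal O(\delta+\gamma\epsilon^n)\|\zeta\|+\mathcal O(\|\zeta\|^2),$$ $$\dot\zeta=\mathcal L_{\phi_0,\gamma}\zeta+\dot s\begin{pmatrix}0\\ \mathcal O(\delta+\epsilon)\end{pmatrix}+\dot\delta\begin{pmatrix}\mathcal O(\delta)\\0\end{pmatrix}+\mathcal O(\|\zeta\|^2),$$ and let $\mathcal F^t$ denote the evolution it defines. Let $t\mapsto x(t)$ be a family of functions (not necessarily a solution of the system) which satisfies $|||\{x\}_T|||\le2$, and define $\mathcal Fx=\{\mathcal F^\tau x\}_{\tau\in[0,T]}$ as the family evolving from $x(0)$ under the system. If $|||\{x\}_0|||\le2$ and $s(0)=\delta(0)=0$, then the solution of the system satisfies $$|||\{\mathcal Fx\}_t|||\le4\quad\text{for all }t\in[0,T].$$ Furthermore, when $|||\{x\}_0|||\le1$ (in particular $\|\zeta(0)\|\le\gamma\epsilon^n$; again $s(0)=\delta(0)=0$), the solution of the system satisfies at time $T$: $$|\delta(T)+2\gamma\epsilon^{2n-1}T|\le2\gamma\epsilon^{2n-1/2}T,$$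 $$\|\zeta(T)\|\le e^{-\kappa_n\gamma\epsilon T/4}e^{-\kappa_n\gamma\epsilon T/2}(1-\gamma\epsilon)^{-1}\bigl(1+\tfrac32C_n\gamma\bigr)\gamma\epsilon^n\le e^{-\kappa_n\gamma\epsilon T/4}\gamma\epsilon^n.$$
   Context: Let $n\ge2$; norms on vectors are Euclidean. $\Delta$ is the $n\times n$ discrete Laplacian $(\Delta w)_j=w_{j-1}-2w_j+w_{j+1}$ for $1<j<n$, $(\Delta w)_1=-w_1+w_2$, $(\Delta w)_n=-w_n+w_{n-1}$. For small $|\phi|,|\epsilon|$, $p(\phi)=p(\phi,\epsilon)\in\mathbb R^n$ is the unique solution near $(1,0,\dots,0)$ of $-\epsilon(\Delta p)_j-(1+\phi)p_j+p_j^3=0$. Set $A_\phi=\epsilon\Delta+(1+\phi)\mathbb 1-\mathrm{diag}(p_j(\phi)^2)$, $B_\phi=-\epsilon\Delta-(1+\phi)\mathbb 1+3\,\mathrm{diag}(p_j(\phi)^2)$, $C_\Gamma=\mathrm{diag}(0,\dots,0,\gamma\epsilon)$, and $$\mathcal L_{\phi_0,\gamma}=\begin{pmatrix}0&A_{\phi_0}\\ B_{\phi_0}&0\end{pmatrix}-\begin{pmatrix}C_\Gamma&0\\0&C_\Gamma\end{pmatrix}.$$ Let $v^{(1)}=(0,p(\phi_0))$, $v^{(2)}=(B_{\phi_0}^{-1}p(\phi_0),0)$, $n^{(1)}=c_1(0,B_{\phi_0}^{-1}p(\phi_0))$, $n^{(2)}=c_2(p(\phi_0),0)$ with $\langle n^{(j)}|v^{(j)}\rangle=1$,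 and $\mathbb P_{\phi_0}=\mathbb 1-\sum_{j=1,2}|v^{(j)}\rangle\langle n^{(j)}|$. The variable $\zeta(t)$ stays in $\mathrm{Range}(\mathbb P_{\phi_0})$. The system is the modulation system obtained by writing solutions of $-\mathrm i\dot w_j=-\epsilon(\Delta w)_j-w_j+|w_j|^2w_j+\mathrm i\gamma\epsilon\delta_{n,j}w_j$ as $w(t)=e^{\mathrm i(t\phi(t)+\theta(t))}(p(\phi(t))+z(t))$, $z=\xi+\mathrm i\eta$, $\zeta=(\xi,\eta)\in\mathrm{Range}(\mathbb P_{\phi_0})$, where $\delta(t)=\phi(t)-\phi_0$ and $\dot s=t\dot\phi+\dot\theta$, $s(0)=0$. Each $\mathcal O(\cdot)$ is a term bounded by a constant depending only on $n$ times the absolute value of its argument (for a sum such as $\delta+\gamma\epsilon^n$, by $|\delta|+\gamma\epsilon^n$). The constants $C_n,\kappa_n>0$ depend only on $n$ and are those of the semigroup bound $\|e^{t\mathcal L_{\phi_0,\gamma}}\zeta\|\le(1+C_n\gamma)e^{-\kappa_n\gamma\epsilon t}\|\zeta\|$ ($t\ge0$, $\zeta\in\mathrm{Range}(\mathbb P_{\phi_0})$). For a family $\{x\}_t=\{x(\tau)\}_{\tau\in[0,t]}$, $x=(s,\delta,\zeta)$, define $$|||\{x\}_t|||=\max\Bigl(\sup_{\tau\in[0,t]}|s(\tau)|,\ \sup_{\tau\in[0,t]}|\delta(\tau)|,\ C_\zeta\sup_{\tau\in[0,t]}\|\zeta(\tau)\|\Bigr),\qquad C_\zeta^{-1}=\gamma\epsilon^n.$$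 *)

theory Defs
  imports "HOL-Analysis.Analysis"
begin

text \<open>
  The sites \<open>1 < \<dots> < n\<close> of the chain are the elements of a finite linearly ordered type \<open>'n\<close>,
  so \<open>n = CARD('n)\<close>. The space of vectors \<open>(\<xi>, \<eta>)\<close> is \<open>(real^'n) \<times> (real^'n)\<close>,
  whose product norm is the Euclidean norm of the \<open>2n\<close> components.
\<close>

type_synonym 'n rvec = "(real, 'n) vec"

type_synonym 'n phase = "'n rvec \<times> 'n rvec"

text \<open>States \<open>(s, \<delta>, \<zeta>)\<close>.\<close>
type_synonym 'n state = "real \<times> real \<times> 'n phase"

definition first_site :: "'n::{finite,linorder}"
  where "first_site = Min UNIV"

definition last_site :: "'n::{finite,linorder}"
  where "last_site = Max UNIV"

definition prev_site :: "'n::{finite,linorder} \<Rightarrow> 'n"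
  where "prev_site j = Max {i. i < j}"

definition next_site :: "'n::{finite,linorder} \<Rightarrow> 'n"
  where "next_site j = Min {i. j < i}"

definition lap :: "'n::{finite,linorder} rvec \<Rightarrow> 'n rvec"
  where "lap w = (\<chi> j.
    if j = first_site then - w $ j + w $ next_site j
    else if j = last_site then - w $ j + w $ prev_site j
    else w $ prev_site j - 2 * w $ j + w $ next_site j)"

definition stationary :: "real \<Rightarrow> real \<Rightarrow> 'n::{finite,linorder} rvec \<Rightarrow> bool"
  where "stationary \<epsilon> \<phi> q \<longleftrightarrow>
    (\<forall>j. - \<epsilon> * lap q $ j - (1 + \<phi>) * q $ j + (q $ j) ^ 3 = 0)"

text \<open>
  ``Near \<open>(1, 0, \<dots>, 0)\<close>'' is made explicit as the ball of radius \<open>1/4\<close>: for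
  \<open>\<epsilon> = \<phi> = 0\<close> the derivative \<open>3 q\<^sub>j\<^sup>2 - 1\<close> of the \<open>j\<close>-th equation stays away from \<open>0\<close>
  there, so for small \<open>\<epsilon>\<close> and \<open>\<phi>\<close> this ball contains exactly one solution.
\<close>
definition breather :: "real \<Rightarrow> real \<Rightarrow> 'n::{finite,linorder} rvec"
  where "breather \<epsilon> \<phi> = (THE q. dist q (axis first_site 1) < 1/4 \<and> stationary \<epsilon> \<phi> q)"

definition A_op :: "real \<Rightarrow> real \<Rightarrow> 'n::{finite,linorder} rvec \<Rightarrow> 'n rvec"
  where "A_op \<epsilon> \<phi> w =
    (\<chi> j. \<epsilon> * lap w $ j + (1 + \<phi>) * w $ j - (breather \<epsilon> \<phi> $ j)\<^sup>2 * w $ j)"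

definition B_op :: "real \<Rightarrow> real \<Rightarrow> 'n::{finite,linorder} rvec \<Rightarrow> 'n rvec"
  where "B_op \<epsilon> \<phi> w =
    (\<chi> j. - \<epsilon> * lap w $ j - (1 + \<phi>) * w $ j + 3 * (breather \<epsilon> \<phi> $ j)\<^sup>2 * w $ j)"

definition C_op :: "real \<Rightarrow> real \<Rightarrow> 'n::{finite,linorder} rvec \<Rightarrow> 'n rvec"
  where "C_op \<epsilon> \<gamma> w = (\<chi> j. if j = last_site then \<gamma> * \<epsilon> * w $ j else 0)"

definition L_op :: "real \<Rightarrow> real \<Rightarrow> real \<Rightarrow> 'n::{finite,linorder} phase \<Rightarrow> 'n phase"
  where "L_op \<epsilon> \<gamma> \<phi>0 = (\<lambda>(\<xi>, \<eta>).
    (A_op \<epsilon> \<phi>0 \<eta> - C_op \<epsilon> \<gamma> \<xi>, B_op \<epsilon> \<phi>0 \<xi> - C_op \<epsilon> \<gamma> \<eta>))"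

text \<open>
  The exponential series of \<open>t L\<close>, applied to a vector. The bound
  \<open>(1 + C \<gamma>) exp (- \<kappa> \<gamma> \<epsilon> t)\<close> for it on the range of the projection is used below only at the
  parameters in question and for \<open>t \<in> [0, T]\<close>: as that range is not invariant under \<open>L\<close>, the
  bound cannot persist for all \<open>t \<ge> 0\<close>.
\<close>
definition semigroup_L :: "real \<Rightarrow> real \<Rightarrow> real \<Rightarrow> real \<Rightarrow> 'n::{finite,linorder} phase \<Rightarrow> 'n phase"
  where "semigroup_L \<epsilon> \<gamma> \<phi>0 t \<zeta> = (\<Sum>k. (t ^ k / fact k) *\<^sub>R (L_op \<epsilon> \<gamma> \<phi>0 ^^ k) \<zeta>)"

definition B_inv_p :: "real \<Rightarrow> real \<Rightarrow> 'n::{finite,linorder} rvec"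
  where "B_inv_p \<epsilon> \<phi> = inv (B_op \<epsilon> \<phi>) (breather \<epsilon> \<phi>)"

definition v1 :: "real \<Rightarrow> real \<Rightarrow> 'n::{finite,linorder} phase"
  where "v1 \<epsilon> \<phi>0 = (0, breather \<epsilon> \<phi>0)"

definition v2 :: "real \<Rightarrow> real \<Rightarrow> 'n::{finite,linorder} phase"
  where "v2 \<epsilon> \<phi>0 = (B_inv_p \<epsilon> \<phi>0, 0)"

definition n1 :: "real \<Rightarrow> real \<Rightarrow> 'n::{finite,linorder} phase"
  where "n1 \<epsilon> \<phi>0 = (1 / ((0, B_inv_p \<epsilon> \<phi>0) \<bullet> (v1 \<epsilon> \<phi>0 :: 'n phase))) *\<^sub>R (0, B_inv_p \<epsilon> \<phi>0)"

definition n2 :: "real \<Rightarrow> real \<Rightarrow> 'n::{finite,linorder} phase"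
  where "n2 \<epsilon> \<phi>0 = (1 / ((breather \<epsilon> \<phi>0, 0) \<bullet> (v2 \<epsilon> \<phi>0 :: 'n phase))) *\<^sub>R (breather \<epsilon> \<phi>0, 0)"

definition P_op :: "real \<Rightarrow> real \<Rightarrow> 'n::{finite,linorder} phase \<Rightarrow> 'n phase"
  where "P_op \<epsilon> \<phi>0 \<zeta> = \<zeta> - (n1 \<epsilon> \<phi>0 \<bullet> \<zeta>) *\<^sub>R v1 \<epsilon> \<phi>0 - (n2 \<epsilon> \<phi>0 \<bullet> \<zeta>) *\<^sub>R v2 \<epsilon> \<phi>0"

text \<open>
  The neighbourhood of the origin on which the \<open>\<O>\<close>-bounds are available; in the modulation
  system \<open>p(\<phi>\<^sub>0 + \<delta>)\<close> exists for small \<open>\<delta>\<close> only.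
\<close>
definition state_nbhd :: "real \<Rightarrow> real \<Rightarrow> real \<Rightarrow> 'n::{finite,linorder} state set"
  where "state_nbhd r \<epsilon> \<phi>0 =
    {(s, \<delta>, \<zeta>). \<bar>s\<bar> \<le> r \<and> \<bar>\<delta>\<bar> \<le> r \<and> norm \<zeta> \<le> r \<and> \<zeta> \<in> range (P_op \<epsilon> \<phi>0)}"

text \<open>
  \<open>F\<close> is a right-hand side of the system: at each state the \<open>\<O>\<close>-terms are numbers
  \<open>a1, a2, b0, b1, b2\<close> and vectors \<open>u1, u2, u3\<close>, obeying their bounds with the common constant
  \<open>K\<close>. They are existentially quantified at each state, i.e. are arbitrary functions of the state.

  The \<open>\<zeta>\<close>-equation is written with \<open>P_op\<close> in front because \<open>\<zeta>\<close> evolves in the range of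
  \<open>P_op\<close>, which \<open>L_op\<close> does not leave invariant when \<open>\<gamma> > 0\<close>. Every solution of the equation
  without \<open>P_op\<close> that stays in the range is a solution of this one, since there
  \<open>d\<zeta>/dt = P_op (d\<zeta>/dt)\<close>.

  The Lipschitz condition concerns the whole field only: it is what makes the system
  define an evolution, and single \<open>\<O>\<close>-terms need not even be continuous at \<open>\<zeta> = 0\<close>.
\<close>
definition modulation_system ::
    "real \<Rightarrow> real \<Rightarrow> real \<Rightarrow> real \<Rightarrow> real \<Rightarrow> ('n::{finite,linorder} state \<Rightarrow> 'n state) \<Rightarrow> bool"
  where "modulation_system K r \<epsilon> \<gamma> \<phi>0 F \<longleftrightarrow>
    (\<exists>M. M-lipschitz_on (state_nbhd r \<epsilon> \<phi>0) F) \<and>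
    (\<forall>(s, \<delta>, \<zeta>) \<in> state_nbhd r \<epsilon> \<phi>0.
      \<exists>a1 a2 b0 b1 b2 u1 u2 u3 ds d\<delta>.
        \<bar>a1\<bar> \<le> K * (\<bar>\<delta>\<bar> + \<gamma> * \<epsilon> ^ CARD('n)) \<and>
        \<bar>a2\<bar> \<le> K * (norm \<zeta>)\<^sup>2 \<and>
        \<bar>b0\<bar> \<le> K * \<bar>\<delta>\<bar> \<and>
        \<bar>b1\<bar> \<le> K * (\<bar>\<delta>\<bar> + \<gamma> * \<epsilon> ^ CARD('n)) \<and>
        \<bar>b2\<bar> \<le> K * (norm \<zeta>)\<^sup>2 \<and>
        norm u1 \<le> K * (\<bar>\<delta>\<bar> + \<epsilon>) \<and>
        norm u2 \<le> K * \<bar>\<delta>\<bar> \<and>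
        norm u3 \<le> K * (norm \<zeta>)\<^sup>2 \<and>
        ds = a1 * norm \<zeta> + a2 \<and>
        d\<delta> = - (2 + b0) * \<gamma> * \<epsilon> ^ (2 * CARD('n) - 1) + b1 * norm \<zeta> + b2 \<and>
        F (s, \<delta>, \<zeta>) =
          (ds, d\<delta>,
           P_op \<epsilon> \<phi>0 (L_op \<epsilon> \<gamma> \<phi>0 \<zeta> + ds *\<^sub>R (0, u1) + d\<delta> *\<^sub>R (u2, 0) + u3)))"

text \<open>\<open>y\<close> is the family evolving from \<open>x0\<close> on \<open>[0, T]\<close>.\<close>
definition evolves ::
    "real \<Rightarrow> real \<Rightarrow> ('n::{finite,linorder} state \<Rightarrow> 'n state) \<Rightarrow> real \<Rightarrow> 'n state
      \<Rightarrow> (real \<Rightarrow> 'n state) \<Rightarrow> bool"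
  where "evolves \<epsilon> \<phi>0 F T x0 y \<longleftrightarrow> y 0 = x0 \<and>
    (\<forall>t\<in>{0..T}. snd (snd (y t)) \<in> range (P_op \<epsilon> \<phi>0) \<and>
      (y has_vector_derivative F (y t)) (at t within {0..T}))"

text \<open>Extended reals, so that the supremum of an unbounded family is infinite.\<close>
definition tnorm :: "real \<Rightarrow> real \<Rightarrow> real \<Rightarrow> (real \<Rightarrow> 'n::{finite,linorder} state) \<Rightarrow> ereal"
  where "tnorm \<epsilon> \<gamma> t x =
    max (SUP \<tau>\<in>{0..t}. ereal \<bar>fst (x \<tau>)\<bar>)
      (max (SUP \<tau>\<in>{0..t}. ereal \<bar>fst (snd (x \<tau>))\<bar>)
        (ereal (inverse (\<gamma> * \<epsilon> ^ CARD('n))) * (SUP \<tau>\<in>{0..t}. ereal (norm (snd (snd (x \<tau>)))))))"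

end

theory Submission
  imports Defs
begin

text \<open>
  On the range of the projection \<open>P\<close> the linear part is \<open>P L\<close>, and not \<open>L\<close>, whose semigroup is
  controlled by hypothesis. The difference \<open>P L \<zeta> - L \<zeta>\<close> lies in the span of \<open>v1\<close> and \<open>v2\<close>, with
  coefficients \<open>O(\<gamma> \<epsilon>\<^sup>2) |\<zeta>|\<close>, because the damping sees only the last site, where \<open>p\<close> and
  \<open>B\<inverse> p\<close> are \<open>O(\<epsilon>)\<close>. As \<open>v1, v2\<close> span a Jordan block of \<open>L\<close> at \<open>\<gamma> = 0\<close>, over times
  \<open>T = O(1/\<epsilon>)\<close> this may build up to a relative size \<open>O(T\<^sup>2 \<gamma> \<epsilon>\<^sup>2) = O(\<gamma>)\<close>, as large as the gain
  \<open>exp (- \<kappa> \<gamma> \<epsilon> T)\<close> itself. It is absorbed into \<open>Z = \<zeta> + a v1 + b v2\<close>, where \<open>a, b\<close> are chosen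
  such that \<open>Z' - L Z\<close> stays in the range of \<open>P\<close> and Duhamel's formula applies. Since this range is
  orthogonal to \<open>v1, v2\<close> up to \<open>O(\<epsilon>)\<close>, one has \<open>|\<zeta>| \<le> |Z| + O(\<epsilon>) (|a| + |b|)\<close>, so that all
  errors are of relative size \<open>O(\<gamma> \<epsilon>)\<close>. The nonlinear terms are of that size too as long as
  \<open>|s| \<le> \<gamma>\<close>, \<open>|\<delta>| = O(\<gamma> \<epsilon>^(2n-2))\<close> and \<open>|\<zeta>| \<le> 4 \<gamma> \<epsilon>^n\<close>, and a continuity argument closes
  these bounds.
\<close>

section \<open>Linear differential equations\<close>

text \<open>The mean value inequality. The derivative is taken within \<open>{0..T}\<close> but
  bounded only up to \<open>t\<close>, the form in which a bootstrap in time can use it.\<close>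

lemma increment_bound:
  fixes f :: "real \<Rightarrow> 'a::real_normed_vector"
  assumes t: "0 \<le> t" "t \<le> T"
    and deriv: "\<And>s. s \<in> {0..T} \<Longrightarrow> (f has_vector_derivative f' s) (at s within {0..T})"
    and bound: "\<And>s. s \<in> {0..t} \<Longrightarrow> norm (f' s) \<le> B"
  shows "norm (f t - f 0) \<le> B * t"
proof -
  have "norm (f t - f 0) \<le> B * norm (t - 0)"
  proof (rule differentiable_bound[where S = "{0..t}" and f' = "\<lambda>s h. h *\<^sub>R f' s"])
    show "(f has_derivative (\<lambda>h. h *\<^sub>R f' s)) (at s within {0..t})" if "s \<in> {0..t}" for s
      using has_vector_derivative_within_subset[OF deriv, of s "{0..t}"] that t
      by (auto simp: has_vector_derivative_def)
    show "onorm (\<lambda>h. h *\<^sub>R f' s) \<le> B" if "s \<in> {0..t}" for s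
      using bound[OF that] by (intro onorm_le) (metis abs_ge_zero mult.commute mult_left_mono norm_scaleR real_norm_def)
  qed (use t in auto)
  then show ?thesis using t by simp
qed

text \<open>Picard iteration in a sup norm weighted by \<open>exp (- 2 * \<Lambda> * t)\<close>: the
  weight makes the integral operator a contraction on all of \<open>{0..T}\<close> at once, so that
  no local solutions have to be glued.\<close>

lemma picard_exists:
  fixes f :: "real \<Rightarrow> 'a::banach \<Rightarrow> 'a"
  assumes T: "0 \<le> T" and \<Lambda>: "0 < \<Lambda>"
    and lip: "\<And>t u v. t \<in> {0..T} \<Longrightarrow> norm (f t u - f t v) \<le> \<Lambda> * norm (u - v)"
    and cont: "\<And>u. continuous_on {0..T} u \<Longrightarrow> continuous_on {0..T} (\<lambda>s. f s (u s))"
  obtains y where "y 0 = x0"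
    and "\<And>t. t \<in> {0..T} \<Longrightarrow> (y has_vector_derivative f t (y t)) (at t within {0..T})"
proof -
  \<comment> \<open>Clamping time to \<open>{0..T}\<close> turns functions on the interval into
    bounded continuous functions on the line, to which Banach's fixed point theorem is
    applied.\<close>
  define cl where "cl t = max 0 (min T t)" for t :: real
  have cl: "cl t \<in> {0..T}" for t using T by (auto simp: cl_def)
  have cl_id: "cl t = t" if "t \<in> {0..T}" for t using that by (auto simp: cl_def)
  \<comment> \<open>The unknown \<open>u\<close> is the sought solution multiplied by the weight, so
    the field is evaluated at \<open>u\<close> with the weight undone.\<close>
  define I where "I u t = x0 + integral {0..t} (\<lambda>s. f s (exp (2 * \<Lambda> * s) *\<^sub>R u s))" for u :: "real \<Rightarrow> 'a" and t
  define \<Phi> where "\<Phi> u t = exp (- 2 * \<Lambda> * cl t) *\<^sub>R I u (cl t)" for u :: "real \<Rightarrow> 'a" and t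
  have cont_f: "continuous_on {0..T} (\<lambda>s. f s (exp (2 * \<Lambda> * s) *\<^sub>R u s))"
    if "continuous_on {0..T} u" for u
    by (intro cont continuous_intros that)
  have I_deriv: "(I u has_vector_derivative f t (exp (2 * \<Lambda> * t) *\<^sub>R u t)) (at t within {0..T})"
    if "continuous_on {0..T} u" "t \<in> {0..T}" for u t
    unfolding I_def
    using has_vector_derivative_add[OF has_vector_derivative_const[of x0]
        integral_has_vector_derivative[OF cont_f[OF that(1)] that(2)]]
    by simp
  have bc: "\<Phi> (apply_bcontfun u) \<in> bcontfun" for u :: "real \<Rightarrow>\<^sub>C 'a"
  proof -
    have "continuous_on {0..T} (I u)"
      by (rule continuous_on_vector_derivative[OF I_deriv]) auto
    then have c: "continuous_on {0..T} (\<lambda>t. exp (- 2 * \<Lambda> * t) *\<^sub>R I u t)"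
      by (intro continuous_intros)
    have "continuous_on UNIV (\<Phi> u)"
      unfolding \<Phi>_def
      by (rule continuous_on_compose2[OF c]) (use cl in \<open>auto simp: cl_def intro!: continuous_intros\<close>)
    moreover have "range (\<Phi> u) \<subseteq> (\<lambda>t. exp (- 2 * \<Lambda> * t) *\<^sub>R I u t) ` {0..T}"
      using cl by (auto simp: \<Phi>_def)
    then have "bounded (range (\<Phi> u))"
      using bounded_subset compact_continuous_image[OF c] compact_imp_bounded by blast
    ultimately show ?thesis by (simp add: bcontfun_def)
  qed
  define \<Psi> where "\<Psi> u = Bcontfun (\<Phi> (apply_bcontfun u))" for u :: "real \<Rightarrow>\<^sub>C 'a"
  have \<Psi>: "apply_bcontfun (\<Psi> u) t = \<Phi> u t" for u t
    by (simp add: \<Psi>_def Bcontfun_inverse[OF bc])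
  have "dist (\<Psi> u) (\<Psi> v) \<le> 1/2 * dist u v" for u v
  proof (rule dist_bound)
    fix t
    define \<tau> where "\<tau> = cl t"
    have \<tau>: "\<tau> \<in> {0..T}" unfolding \<tau>_def by (rule cl)
    have int: "(\<lambda>s. f s (exp (2 * \<Lambda> * s) *\<^sub>R apply_bcontfun w s)) integrable_on {0..\<tau>}" for w
      by (rule integrable_continuous_real, rule continuous_on_subset[OF cont_f]) (use \<tau> in auto)
    \<comment> \<open>The integral of \<open>\<Lambda> * exp (2 * \<Lambda> * s)\<close> is at most
      half of \<open>exp (2 * \<Lambda> * \<tau>)\<close>, which the weight cancels: hence the
      contraction factor 1/2.\<close>
    have hi: "((\<lambda>s. \<Lambda> * exp (2 * \<Lambda> * s) * dist u v) has_integral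
        dist u v / 2 * exp (2 * \<Lambda> * \<tau>) - dist u v / 2 * exp (2 * \<Lambda> * 0)) {0..\<tau>}"
      using \<tau> by (intro fundamental_theorem_of_calculus)
        (auto intro!: derivative_eq_intros simp flip: has_real_derivative_iff_has_vector_derivative)
    have "norm (I u \<tau> - I v \<tau>) =
        norm (integral {0..\<tau>} (\<lambda>s. f s (exp (2 * \<Lambda> * s) *\<^sub>R u s) - f s (exp (2 * \<Lambda> * s) *\<^sub>R v s)))"
      by (simp add: I_def integral_diff[OF int int])
    also have "\<dots> \<le> integral {0..\<tau>} (\<lambda>s. \<Lambda> * exp (2 * \<Lambda> * s) * dist u v)"
    proof (rule integral_norm_bound_integral)
      fix s assume s: "s \<in> {0..\<tau>}"
      then have "norm (f s (exp (2 * \<Lambda> * s) *\<^sub>R u s) - f s (exp (2 * \<Lambda> * s) *\<^sub>R v s))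
          \<le> \<Lambda> * norm (exp (2 * \<Lambda> * s) *\<^sub>R u s - exp (2 * \<Lambda> * s) *\<^sub>R v s)"
        using \<tau> by (intro lip) auto
      also have "\<dots> = \<Lambda> * exp (2 * \<Lambda> * s) * dist (u s) (v s)"
        by (simp add: dist_norm flip: scaleR_diff_right)
      also have "\<dots> \<le> \<Lambda> * exp (2 * \<Lambda> * s) * dist u v"
        using \<Lambda> by (intro mult_left_mono dist_bounded) auto
      finally show "norm (f s (exp (2 * \<Lambda> * s) *\<^sub>R u s) - f s (exp (2 * \<Lambda> * s) *\<^sub>R v s))
          \<le> \<Lambda> * exp (2 * \<Lambda> * s) * dist u v" .
    qed (use integrable_diff[OF int int] hi in \<open>auto simp: has_integral_integrable\<close>)
    also have "\<dots> \<le> dist u v / 2 * exp (2 * \<Lambda> * \<tau>)"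
      unfolding integral_unique[OF hi] by simp
    finally have "exp (- 2 * \<Lambda> * \<tau>) * norm (I u \<tau> - I v \<tau>)
        \<le> exp (- 2 * \<Lambda> * \<tau>) * (dist u v / 2 * exp (2 * \<Lambda> * \<tau>))"
      by (intro mult_left_mono) auto
    also have "\<dots> = 1/2 * dist u v" by (simp add: exp_minus)
    finally show "dist (\<Psi> u t) (\<Psi> v t) \<le> 1/2 * dist u v"
      by (simp add: \<Psi> \<Phi>_def dist_norm \<tau>_def flip: scaleR_diff_right)
  qed
  then have "\<exists>!u. \<Psi> u = u"
    by (intro banach_fix_type[where c = "1/2"]) auto
  then obtain u where u: "\<Psi> u = u" by auto
  define y where "y = I u"
  have eq: "exp (2 * \<Lambda> * t) *\<^sub>R u t = y t" if "t \<in> {0..T}" for t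
  proof -
    have "apply_bcontfun u t = exp (- 2 * \<Lambda> * t) *\<^sub>R y t"
      using \<Psi>[of u t] u by (simp add: \<Phi>_def cl_id[OF that] y_def)
    then show ?thesis by (simp add: exp_minus)
  qed
  show ?thesis
  proof
    show "y 0 = x0" by (simp add: y_def I_def)
    show "(y has_vector_derivative f t (y t)) (at t within {0..T})" if "t \<in> {0..T}" for t
      using I_deriv[of u t] that by (simp add: eq) (simp add: y_def)
  qed
qed

text \<open>If \<open>\<phi>\<close> ever reached 1, then at the first such time it would equal 1
  after being at most 1 before, and \<open>step\<close> would make it smaller than 1 there.\<close>

lemma continuity_bootstrap:
  fixes \<phi> :: "real \<Rightarrow> real"
  assumes cont: "continuous_on {0..T} \<phi>" and init: "\<phi> 0 < 1"
    and step: "\<And>t. t \<in> {0..T} \<Longrightarrow> (\<And>s. s \<in> {0..t} \<Longrightarrow> \<phi> s \<le> 1) \<Longrightarrow> \<phi> t < 1"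
    and t: "t \<in> {0..T}"
  shows "\<phi> t < 1"
proof (rule ccontr)
  assume "\<not> \<phi> t < 1"
  define S where "S = {s \<in> {0..T}. 1 \<le> \<phi> s}"
  have "compact S"
    unfolding S_def using continuous_closed_preimage[OF cont closed_real_atLeastAtMost closed_atLeast[of 1]]
    by (auto simp: compact_eq_bounded_closed Int_def vimage_def intro: bounded_subset[OF bounded_closed_interval])
  moreover have "S \<noteq> {}" using \<open>\<not> \<phi> t < 1\<close> t by (auto simp: S_def)
  ultimately obtain m where m: "m \<in> S" "\<And>s. s \<in> S \<Longrightarrow> m \<le> s"
    using compact_attains_inf by metis
  have "continuous_on {0..m} \<phi>" using cont m by (auto simp: S_def elim!: continuous_on_subset)
  then obtain s where s: "0 \<le> s" "s \<le> m" "\<phi> s = 1"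
    using IVT'[of \<phi> 0 1 m] init m by (auto simp: S_def)
  then have "s = m" using m by (force simp: S_def)
  then have "\<phi> s \<le> 1" if "s \<in> {0..m}" for s
    using that m s by (cases "s = m") (force simp: S_def)+
  then show False using step[of m] m by (auto simp: S_def)
qed

section \<open>The operator exponential and Duhamel's formula\<close>

definition expL :: "('a \<Rightarrow> 'a) \<Rightarrow> real \<Rightarrow> 'a \<Rightarrow> 'a::euclidean_space"
  where "expL L t w = (\<Sum>k. (t ^ k / fact k) *\<^sub>R (L ^^ k) w)"

text \<open>Comparison with the exponential series of \<open>\<bar>t\<bar> * B\<close>, where
  \<open>B\<close> bounds the operator \<open>L\<close>.\<close>

lemma expL_sums:
  fixes L :: "'a \<Rightarrow> 'a::euclidean_space"
  assumes "linear L"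
  shows "(\<lambda>k. (t ^ k / fact k) *\<^sub>R (L ^^ k) w) sums expL L t w"
proof -
  obtain B where B: "B > 0" "\<And>x. norm (L x) \<le> norm x * B"
    using bounded_linear.pos_bounded[OF linear_conv_bounded_linear[THEN iffD1, OF assms]] by blast
  have pow: "norm ((L ^^ k) w) \<le> norm w * B ^ k" for k
  proof (induction k)
    case (Suc k)
    have "norm ((L ^^ Suc k) w) \<le> norm ((L ^^ k) w) * B" using B(2) by simp
    also have "\<dots> \<le> norm w * B ^ k * B" using Suc B by (intro mult_right_mono) auto
    finally show ?case by (simp add: mult_ac)
  qed simp
  have "summable (\<lambda>k. (t ^ k / fact k) *\<^sub>R (L ^^ k) w)"
  proof (rule summable_comparison_test')
    show "summable (\<lambda>k. norm w * (inverse (fact k) * (\<bar>t\<bar> * B) ^ k))"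
      by (intro summable_mult summable_exp)
    show "norm ((t ^ k / fact k) *\<^sub>R (L ^^ k) w) \<le> norm w * (inverse (fact k) * (\<bar>t\<bar> * B) ^ k)" for k
      using mult_left_mono[OF pow[of k], of "\<bar>t ^ k / fact k\<bar>"]
      by (simp add: power_abs power_mult_distrib divide_simps mult_ac)
  qed
  then show ?thesis unfolding expL_def by (rule summable_sums)
qed

lemma expL_linear:
  assumes "linear L"
  shows "linear (expL L t)"
proof (rule linearI)
  have L: "linear (L ^^ k)" for k by (induction k) (auto simp: linear_id[unfolded id_def] id_def linear_compose[unfolded o_def] assms o_def)
  show "expL L t (v + w) = expL L t v + expL L t w" for v w
    using sums_add[OF expL_sums[OF assms, of t v] expL_sums[OF assms, of t w]]
      expL_sums[OF assms, of t "v + w"]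
    by (simp add: linear_add[OF L] scaleR_add_right sums_iff)
  show "expL L t (c *\<^sub>R w) = c *\<^sub>R expL L t w" for c w
    using bounded_linear.sums[OF bounded_linear_scaleR_right[of c] expL_sums[OF assms, of t w]]
      expL_sums[OF assms, of t "c *\<^sub>R w"]
    by (simp add: linear_scale[OF L] mult_ac sums_iff)
qed

lemma expL_0: "expL L 0 w = w"
proof -
  have "(\<lambda>k. (0 ^ k / fact k) *\<^sub>R (L ^^ k) w) = (\<lambda>k. if k = 0 then w else 0)" by (auto simp: fun_eq_iff)
  then show ?thesis unfolding expL_def using suminf_finite[of "{0}" "\<lambda>k. if k = 0 then w else 0"] by simp
qed

text \<open>Each coordinate of the orbit is a power series in time that converges everywhere, so it
  is differentiated term by term. The derivative has \<open>L\<close> acting on \<open>w\<close>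
  first, as Duhamel's formula uses it.\<close>

lemma expL_has_vector_derivative:
  fixes L :: "'a \<Rightarrow> 'a::euclidean_space"
  assumes "linear L"
  shows "((\<lambda>s. expL L s w) has_vector_derivative expL L t (L w)) (at t within S)"
proof -
  have "((\<lambda>s. expL L s w \<bullet> b) has_field_derivative expL L t (L w) \<bullet> b) (at t within S)" for b
  proof -
    define c where "c k = ((L ^^ k) w \<bullet> b) / fact k" for k
    have s: "(\<lambda>k. c k * s ^ k) sums (expL L s w \<bullet> b)" for s
      using bounded_linear.sums[OF bounded_linear_inner_left[of b] expL_sums[OF assms, of s w]]
      by (simp add: c_def mult_ac)
    have d: "(\<lambda>k. diffs c k * s ^ k) sums (expL L s (L w) \<bullet> b)" for s
    proof -
      have "diffs c k * s ^ k = ((s ^ k / fact k) *\<^sub>R (L ^^ k) (L w)) \<bullet> b" for k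
        by (simp add: c_def diffs_def funpow_swap1 del: of_nat_Suc)
      then show ?thesis
        using bounded_linear.sums[OF bounded_linear_inner_left[of b] expL_sums[OF assms, of s "L w"]]
        by simp
    qed
    have "((\<lambda>s. \<Sum>k. c k * s ^ k) has_field_derivative (\<Sum>k. diffs c k * t ^ k)) (at t)"
      by (rule termdiffs_strong_converges_everywhere) (use s in \<open>auto simp: sums_iff\<close>)
    then show ?thesis
      using s d by (auto simp: sums_iff intro: has_field_derivative_at_within)
  qed
  then show ?thesis
    unfolding has_vector_derivative_def has_field_derivative_def
    by (subst has_derivative_componentwise_within) (auto simp: mult_commute_abs)
qed

text \<open>The curve \<open>expL L (t - s) (Z s)\<close> joins \<open>expL L t (Z 0)\<close> to
  \<open>Z t\<close> and has derivative \<open>expL L (t - s) (G s)\<close>. The mean value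
  inequality stands in for the integral in Duhamel's formula, so that only a pointwise bound
  enters.\<close>

lemma duhamel_bound:
  fixes L :: "'a \<Rightarrow> 'a::euclidean_space"
  assumes L: "linear L" and t: "0 \<le> t" "t \<le> T"
    and Z: "\<And>s. s \<in> {0..T} \<Longrightarrow> (Z has_vector_derivative L (Z s) + G s) (at s within {0..T})"
    and bound: "\<And>s. s \<in> {0..t} \<Longrightarrow> norm (expL L (t - s) (G s)) \<le> B"
  shows "norm (Z t) \<le> norm (expL L t (Z 0)) + B * t"
proof -
  have Z': "(Z has_vector_derivative L (Z s) + G s) (at s within {0..t})" if "s \<in> {0..t}" for s
    using has_vector_derivative_within_subset[OF Z, of s "{0..t}"] that t by auto
  define \<phi> where "\<phi> s = expL L (t - s) (Z s)" for s
  \<comment> \<open>Expanding in the basis separates the two ways in which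
    \<open>expL L (t - s) (Z s)\<close> depends on \<open>s\<close>; the product rule then applies
    to each summand.\<close>
  have exp_sum: "expL L r w = (\<Sum>b\<in>Basis. (w \<bullet> b) *\<^sub>R expL L r b)" for r w
  proof -
    have "expL L r w = expL L r (\<Sum>b\<in>Basis. (w \<bullet> b) *\<^sub>R b)" by (simp add: euclidean_representation)
    then show ?thesis
      by (simp add: linear_sum[OF expL_linear[OF L]] linear_scale[OF expL_linear[OF L]])
  qed
  have "(\<phi> has_vector_derivative expL L (t - s) (G s)) (at s within {0..t})" if s: "s \<in> {0..t}" for s
  proof -
    have E: "((\<lambda>s. expL L (t - s) b) has_vector_derivative - expL L (t - s) (L b)) (at s within {0..t})" for b
    proof -
      have "((\<lambda>s. t - s) has_vector_derivative - 1) (at s within {0..t})"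
        using has_vector_derivative_diff[OF has_vector_derivative_const[of t] has_vector_derivative_id] by simp
      from vector_diff_chain_within[OF this expL_has_vector_derivative[OF L]] show ?thesis
        by (simp add: o_def)
    qed
    have zb: "((\<lambda>s. Z s \<bullet> b) has_field_derivative (L (Z s) + G s) \<bullet> b) (at s within {0..t})" for b
      using bounded_linear.has_vector_derivative[OF bounded_linear_inner_left Z'[OF s]]
      by (simp add: has_real_derivative_iff_has_vector_derivative)
    have "((\<lambda>s. \<Sum>b\<in>Basis. (Z s \<bullet> b) *\<^sub>R expL L (t - s) b) has_vector_derivative
       (\<Sum>b\<in>Basis. (Z s \<bullet> b) *\<^sub>R (- expL L (t - s) (L b)) + ((L (Z s) + G s) \<bullet> b) *\<^sub>R expL L (t - s) b))
       (at s within {0..t})"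
      by (intro has_vector_derivative_sum has_vector_derivative_scaleR zb E)
    also have "(\<lambda>s. \<Sum>b\<in>Basis. (Z s \<bullet> b) *\<^sub>R expL L (t - s) b) = \<phi>"
      by (simp add: \<phi>_def fun_eq_iff exp_sum[symmetric])
    also have "(\<Sum>b\<in>Basis. (Z s \<bullet> b) *\<^sub>R (- expL L (t - s) (L b)) + ((L (Z s) + G s) \<bullet> b) *\<^sub>R expL L (t - s) b)
       = - expL L (t - s) (L (Z s)) + expL L (t - s) (L (Z s) + G s)"
    proof -
      have "expL L (t - s) (L (Z s)) = (\<Sum>b\<in>Basis. (Z s \<bullet> b) *\<^sub>R expL L (t - s) (L b))"
      proof -
        have "expL L (t - s) (L (Z s)) = expL L (t - s) (L (\<Sum>b\<in>Basis. (Z s \<bullet> b) *\<^sub>R b))"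
          by (simp add: euclidean_representation)
        then show ?thesis
          by (simp add: linear_sum[OF expL_linear[OF L]] linear_scale[OF expL_linear[OF L]]
              linear_sum[OF L] linear_scale[OF L])
      qed
      then show ?thesis
        by (simp only: scaleR_minus_right sum.distrib sum_negf exp_sum[symmetric])
    qed
    also have "\<dots> = expL L (t - s) (G s)" by (simp add: linear_add[OF expL_linear[OF L]])
    finally show ?thesis .
  qed
  then have "norm (\<phi> t - \<phi> 0) \<le> B * t"
    by (rule increment_bound[OF t(1) order_refl]) (use bound in auto)
  then have "norm (\<phi> t) \<le> norm (\<phi> 0) + B * t"
    using norm_triangle_sub[of "\<phi> t" "\<phi> 0"] by linarith
  then show ?thesis by (simp add: \<phi>_def expL_0)
qed

section \<open>Decay on the range of a projection\<close>

text \<open>Decay of \<open>expL L\<close> on the range of \<open>P\<close> passes to the flow of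
  \<open>P L\<close>, at the price of error terms linear in \<open>S\<close>. The coupling through
  \<open>D\<close> has size \<open>\<sigma>\<close>, \<open>\<tau>\<close> is its effect after the
  quadratic growth in time caused by the Jordan block, and \<open>\<theta>\<close> measures how far
  the range of \<open>P\<close> is from being orthogonal to \<open>v1, v2\<close>.\<close>

lemma projected_decay:
  fixes L D :: "'a \<Rightarrow> 'a::euclidean_space" and v1 v2 n1 n2 :: 'a
  defines "P \<equiv> \<lambda>w. w - (n1 \<bullet> w) *\<^sub>R v1 - (n2 \<bullet> w) *\<^sub>R v2"
  assumes L: "linear L" and D: "linear D"
    and Lv: "L v1 = - D v1" "L v2 = v1 - D v2"
    and PL: "\<And>w. w \<in> range P \<Longrightarrow> P (L w) = L w + (n1 \<bullet> D w) *\<^sub>R v1 + (n2 \<bullet> D w) *\<^sub>R v2"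
    and nD: "\<And>w. \<bar>n1 \<bullet> D w\<bar> \<le> \<sigma> * norm w" "\<And>w. \<bar>n2 \<bullet> D w\<bar> \<le> \<sigma> * norm w"
    and PD: "norm (P (D v1)) \<le> \<sigma>" "norm (P (D v2)) \<le> \<sigma>"
    and v: "norm v1 \<le> \<nu>" "norm v2 \<le> \<nu>"
    and orth: "\<And>w. w \<in> range P \<Longrightarrow> \<bar>w \<bullet> v1\<bar> \<le> \<theta> * norm w" "\<And>w. w \<in> range P \<Longrightarrow> \<bar>w \<bullet> v2\<bar> \<le> \<theta> * norm w"
    and T: "0 \<le> T" and small: "(T\<^sup>2 + 2 * T) * \<sigma> \<le> \<tau>" "\<nu> * \<tau> \<le> 1/2"
    and pos: "0 \<le> \<sigma>" "0 \<le> \<theta>" "0 \<le> M" "0 \<le> \<mu>"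
    and semigroup: "\<And>t w. t \<in> {0..T} \<Longrightarrow> w \<in> range P \<Longrightarrow> norm (expL L t w) \<le> M * exp (- (\<mu> * t)) * norm w"
    and \<zeta>: "\<And>t. t \<in> {0..T} \<Longrightarrow> (\<zeta> has_vector_derivative P (L (\<zeta> t)) + G t) (at t within {0..T})"
    and range: "\<And>t. t \<in> {0..T} \<Longrightarrow> \<zeta> t \<in> range P" "\<And>t. t \<in> {0..T} \<Longrightarrow> G t \<in> range P"
    and bounds: "\<And>t. t \<in> {0..T} \<Longrightarrow> norm (\<zeta> t) \<le> S" "\<And>t. t \<in> {0..T} \<Longrightarrow> norm (G t) \<le> g"
  shows "norm (\<zeta> T) \<le> M * exp (- (\<mu> * T)) * norm (\<zeta> 0) + M * (g + 2 * \<sigma> * \<tau> * S) * T + 4 * \<theta> * \<tau> * S"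
proof -
  have lin_P: "linear P"
    unfolding P_def by (rule linearI) (auto simp: inner_add_right algebra_simps)
  have sub: "subspace (range P)" by (rule linear_subspace_image[OF lin_P subspace_UNIV])
  have bl_D: "bounded_linear D" using D by (simp add: linear_conv_bounded_linear)
  \<comment> \<open>\<open>W\<close> is the linear part of the system
    \<open>a' = b - n1 \<bullet> D Z\<close>, \<open>b' = - (n2 \<bullet> D Z)\<close>, which is a
    differential equation for \<open>(a, b)\<close> because \<open>Z\<close> itself contains
    \<open>a\<close> and \<open>b\<close>.\<close>
  define V where "V u = fst u *\<^sub>R v1 + snd u *\<^sub>R v2" for u :: "real \<times> real"
  define W where "W u = (snd u - n1 \<bullet> D (V u), - (n2 \<bullet> D (V u)))" for u :: "real \<times> real"
  have "linear W"
    unfolding W_def V_def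
    by (rule linearI) (auto simp: linear_add[OF D] linear_scale[OF D] inner_add_right algebra_simps)
  then have bl_W: "bounded_linear W" by (simp add: linear_conv_bounded_linear)
  then obtain \<Lambda> where \<Lambda>: "\<Lambda> > 0" "\<And>u. norm (W u) \<le> norm u * \<Lambda>"
    using bounded_linear.pos_bounded by blast
  have cont_\<zeta>: "continuous_on {0..T} \<zeta>"
    by (rule continuous_on_vector_derivative[OF \<zeta>])
  define f where "f t u = W u - (n1 \<bullet> D (\<zeta> t), n2 \<bullet> D (\<zeta> t))" for t u
  obtain u where u0: "u 0 = 0"
    and u: "\<And>t. t \<in> {0..T} \<Longrightarrow> (u has_vector_derivative f t (u t)) (at t within {0..T})"
  proof (rule picard_exists[OF T \<Lambda>(1), of f 0])
    show "norm (f t x - f t y) \<le> \<Lambda> * norm (x - y)" for t x y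
      using \<Lambda>(2)[of "x - y"] by (simp add: f_def linear_diff[OF \<open>linear W\<close>] mult.commute)
    show "continuous_on {0..T} (\<lambda>t. f t (x t))" if "continuous_on {0..T} x" for x
      unfolding f_def
      by (intro continuous_intros bounded_linear.continuous_on[OF bl_W] bounded_linear.continuous_on[OF bl_D]
          that cont_\<zeta>)
  qed blast
  define a where "a t = fst (u t)" for t
  define b where "b t = snd (u t)" for t
  define Z where "Z t = \<zeta> t + a t *\<^sub>R v1 + b t *\<^sub>R v2" for t
  have DZ: "D (Z t) = D (\<zeta> t) + D (V (u t))" for t
    by (simp add: Z_def V_def a_def b_def linear_add[OF D] add.assoc)
  have a': "(a has_vector_derivative b t - n1 \<bullet> D (Z t)) (at t within {0..T})" if "t \<in> {0..T}" for t
    using bounded_linear.has_vector_derivative[OF bounded_linear_fst u[OF that]]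
    by (simp add: f_def W_def DZ inner_add_right a_def[abs_def] b_def algebra_simps)
  have b': "(b has_vector_derivative - (n2 \<bullet> D (Z t))) (at t within {0..T})" if "t \<in> {0..T}" for t
  proof -
    have "- (n2 \<bullet> D (Z t)) = snd (f t (u t))" by (simp add: f_def W_def DZ inner_add_right)
    then show ?thesis
      using bounded_linear.has_vector_derivative[OF bounded_linear_snd u[OF that]]
      by (simp add: b_def[abs_def])
  qed
  have ab0: "a 0 = 0" "b 0 = 0" by (simp_all add: a_def b_def u0)
  have \<nu>0: "0 \<le> \<nu>" using order_trans[OF norm_ge_zero v(1)] .
  have S0: "0 \<le> S" using order_trans[OF norm_ge_zero bounds(1)[of 0]] T by simp
  have \<tau>0: "0 \<le> \<tau>"
  proof -
    have "0 \<le> (T\<^sup>2 + 2 * T) * \<sigma>" using T pos(1) by simp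
    then show ?thesis using small(1) by linarith
  qed
  \<comment> \<open>The bounds on \<open>a\<close> and \<open>b\<close> go through \<open>Z\<close>
    and are therefore circular. They are closed at the time \<open>t0\<close> where the sum of the
    two absolute values is largest.\<close>
  have "continuous_on {0..T} (\<lambda>t. \<bar>a t\<bar> + \<bar>b t\<bar>)"
    by (intro continuous_intros continuous_on_vector_derivative[OF a'] continuous_on_vector_derivative[OF b'])
  then obtain t0 where t0: "t0 \<in> {0..T}" "\<And>t. t \<in> {0..T} \<Longrightarrow> \<bar>a t\<bar> + \<bar>b t\<bar> \<le> \<bar>a t0\<bar> + \<bar>b t0\<bar>"
    using continuous_attains_sup[of "{0..T}" "\<lambda>t. \<bar>a t\<bar> + \<bar>b t\<bar>"] T by force
  define m where "m = \<bar>a t0\<bar> + \<bar>b t0\<bar>"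
  define X where "X = S + \<nu> * m"
  have X0: "0 \<le> X" using S0 \<nu>0 by (simp add: X_def m_def)
  have Z_bound: "norm (Z t) \<le> X" if "t \<in> {0..T}" for t
  proof -
    have "norm (a t *\<^sub>R v1) \<le> \<bar>a t\<bar> * \<nu>" "norm (b t *\<^sub>R v2) \<le> \<bar>b t\<bar> * \<nu>"
      using v by (auto intro: mult_left_mono)
    moreover have "(\<bar>a t\<bar> + \<bar>b t\<bar>) * \<nu> \<le> m * \<nu>"
      using t0(2)[OF that] \<nu>0 by (intro mult_right_mono) (auto simp: m_def)
    ultimately show ?thesis
      using norm_triangle_ineq[of "\<zeta> t + a t *\<^sub>R v1" "b t *\<^sub>R v2"] norm_triangle_ineq[of "\<zeta> t" "a t *\<^sub>R v1"]
        bounds(1)[OF that] by (simp add: Z_def X_def algebra_simps)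
  qed
  have nDZ: "\<bar>n1 \<bullet> D (Z t)\<bar> \<le> \<sigma> * X" "\<bar>n2 \<bullet> D (Z t)\<bar> \<le> \<sigma> * X" if "t \<in> {0..T}" for t
    using nD[of "Z t"] mult_left_mono[OF Z_bound[OF that] pos(1)] by linarith+
  \<comment> \<open>\<open>b\<close> is integrated once and then feeds the equation of
    \<open>a\<close>, which yields the factor \<open>T\<^sup>2\<close>.\<close>
  have b_bound: "\<bar>b t\<bar> \<le> \<sigma> * X * T" if "t \<in> {0..T}" for t
  proof -
    have "norm (b t - b 0) \<le> \<sigma> * X * t"
      by (rule increment_bound[OF _ _ b']) (use that nDZ in auto)
    also have "\<dots> \<le> \<sigma> * X * T" using that X0 pos(1) by (intro mult_left_mono) auto
    finally show ?thesis by (simp add: ab0)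
  qed
  have a_bound: "\<bar>a t\<bar> \<le> (\<sigma> * X * T + \<sigma> * X) * T" if "t \<in> {0..T}" for t
  proof -
    have "\<bar>b s - n1 \<bullet> D (Z s)\<bar> \<le> \<sigma> * X * T + \<sigma> * X" if "s \<in> {0..T}" for s
      using b_bound[OF that] nDZ(1)[OF that] by linarith
    then have "norm (a t - a 0) \<le> (\<sigma> * X * T + \<sigma> * X) * t"
      by (intro increment_bound[OF _ _ a']) (use that in auto)
    also have "\<dots> \<le> (\<sigma> * X * T + \<sigma> * X) * T" using that X0 pos(1) T by (intro mult_left_mono) auto
    finally show ?thesis by (simp add: ab0)
  qed
  have m_bound: "m \<le> 2 * \<tau> * S"
  proof -
    have "m \<le> (T\<^sup>2 + 2 * T) * \<sigma> * X"
      using a_bound[OF t0(1)] b_bound[OF t0(1)] by (simp add: m_def power2_eq_square algebra_simps)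
    also have "\<dots> \<le> \<tau> * X" using small(1) X0 by (rule mult_right_mono)
    also have "\<dots> = \<tau> * S + (\<nu> * \<tau>) * m" by (simp add: X_def algebra_simps)
    \<comment> \<open>The factor 1/2 lets the term in \<open>m\<close> be absorbed by the left-hand
      side.\<close>
    also have "\<dots> \<le> \<tau> * S + (1/2) * m"
      using small(2) by (intro add_left_mono mult_right_mono) (auto simp: m_def)
    finally show ?thesis by simp
  qed
  have ab_bound: "\<bar>a t\<bar> + \<bar>b t\<bar> \<le> 2 * \<tau> * S" if "t \<in> {0..T}" for t
    using t0(2)[OF that] m_bound by (simp add: m_def)
  \<comment> \<open>\<open>H\<close> is \<open>Z' - L Z\<close>. The equations of \<open>a\<close>
    and \<open>b\<close> are made such that the \<open>v1, v2\<close> components due to the damping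
    combine to the projections in \<open>H\<close>, so the semigroup bound is available for
    it.\<close>
  define H where "H t = G t + a t *\<^sub>R P (D v1) + b t *\<^sub>R P (D v2)" for t
  have H_range: "H t \<in> range P" if "t \<in> {0..T}" for t
    unfolding H_def using range(2)[OF that] by (intro subspace_add[OF sub] subspace_scale[OF sub]) auto
  have H_bound: "norm (H t) \<le> g + 2 * \<sigma> * \<tau> * S" if "t \<in> {0..T}" for t
  proof -
    have "norm (a t *\<^sub>R P (D v1)) \<le> \<bar>a t\<bar> * \<sigma>" "norm (b t *\<^sub>R P (D v2)) \<le> \<bar>b t\<bar> * \<sigma>"
      using PD by (auto intro: mult_left_mono)
    moreover have "(\<bar>a t\<bar> + \<bar>b t\<bar>) * \<sigma> \<le> 2 * \<tau> * S * \<sigma>"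
      using ab_bound[OF that] pos(1) by (rule mult_right_mono)
    ultimately show ?thesis
      using norm_triangle_ineq[of "G t + a t *\<^sub>R P (D v1)" "b t *\<^sub>R P (D v2)"]
        norm_triangle_ineq[of "G t" "a t *\<^sub>R P (D v1)"] bounds(2)[OF that]
      by (simp add: H_def algebra_simps)
  qed
  have Z': "(Z has_vector_derivative L (Z t) + H t) (at t within {0..T})" if t: "t \<in> {0..T}" for t
  proof -
    have "(Z has_vector_derivative P (L (\<zeta> t)) + G t + (b t - n1 \<bullet> D (Z t)) *\<^sub>R v1
        + (- (n2 \<bullet> D (Z t))) *\<^sub>R v2) (at t within {0..T})"
      unfolding Z_def[abs_def]
      using has_vector_derivative_scaleR[OF a'[OF t, folded has_real_derivative_iff_has_vector_derivative]
          has_vector_derivative_const[of v1]]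
        has_vector_derivative_scaleR[OF b'[OF t, folded has_real_derivative_iff_has_vector_derivative]
          has_vector_derivative_const[of v2]]
      by (intro has_vector_derivative_add \<zeta> t) (simp_all add: Z_def)
    moreover have "P (L (\<zeta> t)) + G t + (b t - n1 \<bullet> D (Z t)) *\<^sub>R v1 + (- (n2 \<bullet> D (Z t))) *\<^sub>R v2
        = L (Z t) + H t"
    proof -
      have "L (Z t) = L (\<zeta> t) - a t *\<^sub>R D v1 + b t *\<^sub>R (v1 - D v2)"
        by (simp add: Z_def linear_add[OF L] linear_scale[OF L] Lv)
      moreover have "D (Z t) = D (\<zeta> t) + a t *\<^sub>R D v1 + b t *\<^sub>R D v2"
        by (simp add: Z_def linear_add[OF D] linear_scale[OF D])
      ultimately show ?thesis
        unfolding PL[OF range(1)[OF t]] H_def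
        by (simp add: P_def inner_add_right algebra_simps)
    qed
    ultimately show ?thesis by simp
  qed
  have Z0: "Z 0 = \<zeta> 0" by (simp add: Z_def ab0)
  have "norm (Z T) \<le> norm (expL L T (Z 0)) + (M * (g + 2 * \<sigma> * \<tau> * S)) * T"
  proof (rule duhamel_bound[OF L T order_refl Z'])
    fix s assume s: "s \<in> {0..T}"
    have "norm (expL L (T - s) (H s)) \<le> M * exp (- (\<mu> * (T - s))) * norm (H s)"
      using s H_range by (intro semigroup) auto
    \<comment> \<open>In the forcing term the decay factor is estimated by 1; only the initial value
      keeps it.\<close>
    also have "\<dots> \<le> M * 1 * (g + 2 * \<sigma> * \<tau> * S)"
      using s pos H_bound[OF s] by (intro mult_mono) auto
    finally show "norm (expL L (T - s) (H s)) \<le> M * (g + 2 * \<sigma> * \<tau> * S)" by simp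
  qed
  also have "norm (expL L T (Z 0)) \<le> M * exp (- (\<mu> * T)) * norm (\<zeta> 0)"
    using T range(1)[of 0] unfolding Z0 by (intro semigroup) auto
  finally have ZT: "norm (Z T) \<le> M * exp (- (\<mu> * T)) * norm (\<zeta> 0) + M * (g + 2 * \<sigma> * \<tau> * S) * T"
    by simp
  define h where "h = 4 * \<theta> * \<tau> * S"
  have h0: "0 \<le> h" using pos \<tau>0 S0 by (simp add: h_def)
  define N where "N = norm (\<zeta> T)"
  define U where "U = a T *\<^sub>R v1 + b T *\<^sub>R v2"
  \<comment> \<open>As \<open>\<zeta>\<close> is almost orthogonal to \<open>v1\<close> and \<open>v2\<close>, dropping them from \<open>Z\<close> costs only \<open>\<theta>\<close> times
    their coefficients, which is smaller than the triangle inequality would give.\<close>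
  have "N\<^sup>2 \<le> (norm (Z T))\<^sup>2 + h * N"
  proof -
    have "\<zeta> T \<bullet> U = a T * (\<zeta> T \<bullet> v1) + b T * (\<zeta> T \<bullet> v2)"
      by (simp add: U_def inner_add_right)
    moreover have "\<bar>a T * (\<zeta> T \<bullet> v1)\<bar> \<le> \<bar>a T\<bar> * (\<theta> * N)" "\<bar>b T * (\<zeta> T \<bullet> v2)\<bar> \<le> \<bar>b T\<bar> * (\<theta> * N)"
      using orth[OF range(1)[of T]] T by (auto simp: abs_mult N_def intro!: mult_left_mono)
    moreover have "(\<bar>a T\<bar> + \<bar>b T\<bar>) * (\<theta> * N) \<le> 2 * \<tau> * S * (\<theta> * N)"
      using ab_bound[of T] T pos by (intro mult_right_mono) (auto simp: N_def)
    ultimately have "- (\<zeta> T \<bullet> U) \<le> 2 * \<tau> * S * (\<theta> * N)" by (simp add: algebra_simps)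
    moreover have "(norm (Z T))\<^sup>2 = N\<^sup>2 + 2 * (\<zeta> T \<bullet> U) + (norm U)\<^sup>2"
      by (simp add: Z_def U_def N_def power2_norm_eq_inner inner_add_left inner_add_right inner_commute)
    ultimately show ?thesis using zero_le_power2[of "norm U"] by (simp add: h_def algebra_simps)
  qed
  \<comment> \<open>The quadratic inequality is resolved for \<open>N\<close>: multiplying
    \<open>norm (Z T) + h < N\<close> by \<open>N\<close> would contradict it.\<close>
  then have "N \<le> norm (Z T) + h"
  proof (rule contrapos_pp)
    assume "\<not> N \<le> norm (Z T) + h"
    then have c: "norm (Z T) + h < N" by simp
    have "(norm (Z T))\<^sup>2 + h * N \<le> norm (Z T) * N + h * N"
      using c h0 by (auto simp: power2_eq_square intro!: mult_left_mono)
    also have "\<dots> < N * N"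
      using mult_strict_right_mono[OF c, of N] c h0 norm_ge_zero[of "Z T"] by (simp add: algebra_simps)
    finally show "\<not> N\<^sup>2 \<le> (norm (Z T))\<^sup>2 + h * N" by (simp add: power2_eq_square)
  qed
  then show ?thesis using ZT by (simp add: N_def h_def)
qed

section \<open>The stationary solution\<close>

lemma first_site_le: "first_site \<le> j"
  by (simp add: first_site_def)

lemma last_site_ge: "j \<le> last_site"
  by (simp add: last_site_def)

lemma first_neq_last:
  assumes "CARD('n::{finite,linorder}) \<ge> 2"
  shows "(first_site :: 'n) \<noteq> last_site"
proof
  assume eq: "(first_site :: 'n) = last_site"
  have "j = first_site" for j :: 'n
    using first_site_le[of j] last_site_ge[of j] eq by simp
  then have "(UNIV :: 'n set) = {first_site}" by auto
  then have "CARD('n) = 1" by (metis card.empty card_insert_disjoint empty_iff finite.emptyI One_nat_def)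
  then show False using assms by simp
qed

lemma next_site_gt: "i \<noteq> last_site \<Longrightarrow> i < next_site i"
  and prev_site_lt: "i \<noteq> first_site \<Longrightarrow> prev_site i < i"
proof -
  show "i < next_site i" if "i \<noteq> last_site"
  proof -
    have "last_site \<in> {j. i < j}" using that last_site_ge[of i] by auto
    then have "Min {j. i < j} \<in> {j. i < j}" by (intro Min_in) auto
    then show ?thesis by (simp add: next_site_def)
  qed
  show "prev_site i < i" if "i \<noteq> first_site"
  proof -
    have "first_site \<in> {j. j < i}" using that first_site_le[of i] by auto
    then have "Max {j. j < i} \<in> {j. j < i}" by (intro Max_in) auto
    then show ?thesis by (simp add: prev_site_def)
  qed
qed

lemma next_site_le: "i < j \<Longrightarrow> next_site i \<le> j"
  and prev_site_ge: "j < i \<Longrightarrow> j \<le> prev_site i"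
  by (auto simp: next_site_def prev_site_def)

lemma prev_next_site: "i \<noteq> last_site \<Longrightarrow> prev_site (next_site i) = i"
  and next_prev_site: "i \<noteq> first_site \<Longrightarrow> next_site (prev_site i) = i"
proof -
  show "prev_site (next_site i) = i" if "i \<noteq> last_site"
  proof (rule antisym)
    have f: "next_site i \<noteq> first_site"
      using next_site_gt[OF that] first_site_le[of i] by auto
    show "prev_site (next_site i) \<le> i"
      using prev_site_lt[OF f] next_site_le[of i "prev_site (next_site i)"] by (meson leD leI)
    show "i \<le> prev_site (next_site i)" by (rule prev_site_ge[OF next_site_gt[OF that]])
  qed
  show "next_site (prev_site i) = i" if "i \<noteq> first_site"
  proof (rule antisym)
    have l: "prev_site i \<noteq> last_site"
      using prev_site_lt[OF that] last_site_ge[of i] by auto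
    show "i \<le> next_site (prev_site i)"
      using next_site_gt[OF l] prev_site_ge[of "next_site (prev_site i)" i] by (meson leD leI)
    show "next_site (prev_site i) \<le> i" by (rule next_site_le[OF prev_site_lt[OF that]])
  qed
qed

lemma next_site_neq_first: "i \<noteq> last_site \<Longrightarrow> next_site i \<noteq> first_site"
  using next_site_gt[of i] first_site_le[of i] by auto

lemma prev_site_neq_last: "i \<noteq> first_site \<Longrightarrow> prev_site i \<noteq> last_site"
  using prev_site_lt[of i] last_site_ge[of i] by auto

text \<open>Summation by parts. The free ends leave no boundary terms, and the right-hand side is
  symmetric in \<open>u\<close> and \<open>w\<close>, whence
  \<open>lap_self_adjoint\<close>.\<close>

lemma lap_inner:
  fixes u w :: "'n::{finite,linorder} rvec"
  assumes "CARD('n) \<ge> 2"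
  shows "u \<bullet> lap w = - (\<Sum>i\<in>UNIV - {last_site}. (u $ next_site i - u $ i) * (w $ next_site i - w $ i))"
proof -
  have fl: "(first_site :: 'n) \<noteq> last_site" by (rule first_neq_last[OF assms])
  have "lap w $ j = (if j \<noteq> last_site then w $ next_site j - w $ j else 0)
      + (if j \<noteq> first_site then w $ prev_site j - w $ j else 0)" for j
    using fl by (auto simp: lap_def)
  then have "u \<bullet> lap w = (\<Sum>j\<in>UNIV. if j \<noteq> last_site then u $ j * (w $ next_site j - w $ j) else 0)
      + (\<Sum>j\<in>UNIV. if j \<noteq> first_site then u $ j * (w $ prev_site j - w $ j) else 0)"
    unfolding inner_vec_def sum.distrib[symmetric] by (intro sum.cong) (auto simp: distrib_left)
  also have "(\<Sum>j\<in>UNIV. if j \<noteq> last_site then u $ j * (w $ next_site j - w $ j) else 0)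
      = (\<Sum>j\<in>UNIV - {last_site}. u $ j * (w $ next_site j - w $ j))"
    by (intro sum.mono_neutral_cong_right) auto
  also have "(\<Sum>j\<in>UNIV. if j \<noteq> first_site then u $ j * (w $ prev_site j - w $ j) else 0)
      = (\<Sum>j\<in>UNIV - {first_site}. u $ j * (w $ prev_site j - w $ j))"
    by (intro sum.mono_neutral_cong_right) auto
  \<comment> \<open>The backward differences are indexed by the left end of each bond, to be
    combined with the forward ones.\<close>
  also have "\<dots> = (\<Sum>i\<in>UNIV - {last_site}. u $ next_site i * (w $ i - w $ next_site i))"
    by (rule sum.reindex_bij_witness[where i = next_site and j = prev_site])
      (auto simp: prev_next_site next_prev_site next_site_neq_first prev_site_neq_last)
  finally show ?thesis
    by (simp add: sum_negf[symmetric] sum.distrib[symmetric] algebra_simps)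
qed

lemma lap_self_adjoint:
  fixes u w :: "'n::{finite,linorder} rvec"
  assumes "CARD('n) \<ge> 2"
  shows "u \<bullet> lap w = lap u \<bullet> w"
  by (simp add: lap_inner[OF assms] inner_commute[of "lap u"] mult.commute)

lemma lap_linear: "linear lap"
  by (rule linearI) (auto simp: lap_def vec_eq_iff algebra_simps)

lemma lap_bound: "\<bar>lap w $ j\<bar> \<le> 4 * norm w"
  using component_le_norm_cart[of w j] component_le_norm_cart[of w "prev_site j"]
    component_le_norm_cart[of w "next_site j"]
  by (auto simp: lap_def)

lemma norm_le_card_cart:
  fixes w :: "'n::finite rvec"
  assumes "\<And>j. \<bar>w $ j\<bar> \<le> a"
  shows "norm w \<le> real CARD('n) * a"
  using norm_le_l1_cart[of w] sum_bounded_above[of UNIV "\<lambda>j. \<bar>w $ j\<bar>" a] assms by simp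

text \<open>The factor \<open>N\<close> in the smallness conditions pays for the passage from
  components to norms in \<open>norm_le_card_cart\<close>.\<close>

locale small_parameters =
  fixes \<epsilon> \<phi> :: real and p x :: "'n::{finite,linorder} rvec" and N :: real
  assumes card: "CARD('n) \<ge> 2" and N_eq: "N = real CARD('n)"
    and \<epsilon>_pos: "0 < \<epsilon>" and \<epsilon>_less: "200 * N * \<epsilon> < 1" and \<phi>_less: "200 * N * \<bar>\<phi>\<bar> < 1"
    and p_eq: "p = breather \<epsilon> \<phi>" and x_eq: "x = B_inv_p \<epsilon> \<phi>"
begin

lemma N_ge: "2 \<le> N" using card by (simp add: N_eq)

lemma \<epsilon>_small: "\<epsilon> \<le> 1/400" and \<phi>_small: "\<bar>\<phi>\<bar> \<le> 1/400"
proof -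
  have "200 * 2 * \<epsilon> \<le> 200 * N * \<epsilon>" "200 * 2 * \<bar>\<phi>\<bar> \<le> 200 * N * \<bar>\<phi>\<bar>"
    using N_ge \<epsilon>_pos by (intro mult_right_mono; simp)+
  then show "\<epsilon> \<le> 1/400" "\<bar>\<phi>\<bar> \<le> 1/400" using \<epsilon>_less \<phi>_less by linarith+
qed

lemma lap_scaled_bound: "\<bar>\<epsilon> * lap w $ j\<bar> \<le> 4 * \<epsilon> * norm w" for w :: "'n rvec"
  using mult_left_mono[OF lap_bound[of w j], of \<epsilon>] \<epsilon>_pos by (simp add: abs_mult)

lemma ball_components:
  assumes "dist q (axis first_site 1 :: 'n rvec) < 1/4"
  shows "3/4 < q $ first_site" "q $ first_site < 5/4" "j \<noteq> first_site \<Longrightarrow> \<bar>q $ j\<bar> < 1/4"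
proof -
  have "\<bar>q $ j - axis first_site 1 $ j\<bar> < 1/4" for j
    using component_le_norm_cart[of "q - axis first_site 1" j] assms by (simp add: dist_norm)
  note c = this
  have "\<bar>q $ first_site - 1\<bar> < 1/4" using c[of first_site] by (simp add: axis_def)
  then show "3/4 < q $ first_site" "q $ first_site < 5/4" by linarith+
  show "\<bar>q $ j\<bar> < 1/4" if "j \<noteq> first_site" using c[of j] that by (simp add: axis_def)
qed

text \<open>Diagonal dominance makes the solutions of \<open>d\<^sub>j w\<^sub>j = \<epsilon> (\<Delta>w)\<^sub>j + f\<^sub>j\<close> small where \<open>f\<close> is small.\<close>

lemma dominant_component:
  fixes w :: "'n rvec"
  assumes "d * w $ j = \<epsilon> * lap w $ j + f" "1/2 \<le> \<bar>d\<bar>"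
  shows "\<bar>w $ j\<bar> \<le> 2 * \<bar>f\<bar> + 8 * \<epsilon> * norm w"
proof -
  have "1/2 * \<bar>w $ j\<bar> \<le> \<bar>d\<bar> * \<bar>w $ j\<bar>" using assms(2) by (intro mult_right_mono) auto
  also have "\<dots> = \<bar>\<epsilon> * lap w $ j + f\<bar>" by (simp add: assms(1) flip: abs_mult)
  also have "\<dots> \<le> 4 * \<epsilon> * norm w + \<bar>f\<bar>" using lap_scaled_bound[of w j] by linarith
  finally show ?thesis by simp
qed

text \<open>Without a source the dominance estimate bounds \<open>norm w\<close> by a multiple of
  itself smaller than 1. This serves both the uniqueness of \<open>p\<close> and the injectivity of
  \<open>B_op\<close>.\<close>

lemma dominant_zero:
  fixes w :: "'n rvec"
  assumes "\<And>j. d j * w $ j = \<epsilon> * lap w $ j" "\<And>j. 1/2 \<le> \<bar>d j\<bar>"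
  shows "w = 0"
proof -
  have "norm w \<le> real CARD('n) * (8 * \<epsilon> * norm w)"
    proof (rule norm_le_card_cart)
    show "\<bar>w $ j\<bar> \<le> 8 * \<epsilon> * norm w" for j
      using dominant_component[of "d j" w j 0] assms[of j] by simp
  qed
  then have "(1 - 8 * N * \<epsilon>) * norm w \<le> 0" by (simp add: N_eq algebra_simps)
  moreover have "0 < 1 - 8 * N * \<epsilon>" using \<epsilon>_less by linarith
  ultimately show ?thesis by (simp add: mult_le_0_iff)
qed

text \<open>Factoring the difference of cubes shows that \<open>q - q'\<close> solves a homogeneous
  diagonally dominant system, with \<open>d j\<close> above 1/2 at the first site and below -1/2
  elsewhere.\<close>

lemma stationary_unique:
  assumes q: "dist q (axis first_site 1 :: 'n rvec) < 1/4" "stationary \<epsilon> \<phi> q"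
    and q': "dist q' (axis first_site 1) < 1/4" "stationary \<epsilon> \<phi> q'"
  shows "q = q'"
proof -
  define d where "d j = (q $ j)\<^sup>2 + q $ j * q' $ j + (q' $ j)\<^sup>2 - (1 + \<phi>)" for j
  have "q - q' = 0"
  proof (rule dominant_zero[of d])
    fix j
    have "(- \<epsilon> * lap q $ j - (1 + \<phi>) * q $ j + (q $ j) ^ 3) - (- \<epsilon> * lap q' $ j - (1 + \<phi>) * q' $ j + (q' $ j) ^ 3) = 0"
      using q(2) q'(2) unfolding stationary_def by (metis diff_zero)
    then show "d j * (q - q') $ j = \<epsilon> * lap (q - q') $ j"
      by (simp add: d_def linear_diff[OF lap_linear] algebra_simps power2_eq_square power3_eq_cube)
    show "1/2 \<le> \<bar>d j\<bar>"
    proof (cases "j = first_site")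
      case True
      have "(3/4)\<^sup>2 \<le> (q $ j)\<^sup>2" "(3/4)\<^sup>2 \<le> (q' $ j)\<^sup>2"
        using ball_components(1)[OF q(1)] ball_components(1)[OF q'(1)] True by (intro power_mono; simp)+
      moreover have "3/4 * (3/4) \<le> q $ j * q' $ j"
        using ball_components(1)[OF q(1)] ball_components(1)[OF q'(1)] True by (intro mult_mono) auto
      ultimately show ?thesis using \<phi>_small by (simp add: d_def power2_eq_square)
    next
      case False
      have b: "\<bar>q $ j\<bar> \<le> 1/4" "\<bar>q' $ j\<bar> \<le> 1/4"
        using ball_components(3)[OF q(1) False] ball_components(3)[OF q'(1) False] by simp_all
      have "\<bar>q $ j\<bar> * \<bar>q $ j\<bar> \<le> 1/4 * (1/4)" "\<bar>q' $ j\<bar> * \<bar>q' $ j\<bar> \<le> 1/4 * (1/4)" "\<bar>q $ j\<bar> * \<bar>q' $ j\<bar> \<le> 1/4 * (1/4)"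
        using b by (intro mult_mono; simp)+
      then have "(q $ j)\<^sup>2 \<le> 1/16" "(q' $ j)\<^sup>2 \<le> 1/16" "q $ j * q' $ j \<le> 1/16"
        by (auto simp: power2_eq_square simp flip: abs_mult)
      then show ?thesis using \<phi>_small by (simp add: d_def)
    qed
  qed
  then show ?thesis by simp
qed

text \<open>Brouwer's theorem, on a cube that a Newton-type map sends into itself; uniqueness is
  left to \<open>stationary_unique\<close>.\<close>

lemma stationary_exists: "\<exists>q. dist q (axis first_site 1 :: 'n rvec) < 1/4 \<and> stationary \<epsilon> \<phi> q"
proof -
  \<comment> \<open>Half the side length of the cube, such that the cube lies within distance
    \<open>N * a = 1/8\<close> of \<open>e\<close>.\<close>
  define a where "a = 1 / (8 * N)"
  define e where "e = (axis first_site 1 :: 'n rvec)"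
  have a: "0 < a" "a \<le> 1/16" "25 * \<epsilon> \<le> a" "25 * \<bar>\<phi>\<bar> \<le> a" "N * a = 1/8"
    using N_ge \<epsilon>_less \<phi>_less by (auto simp: a_def field_simps)
  define S where "S = cbox (\<chi> j. e $ j - a) (\<chi> j. e $ j + a)"
  have S: "q \<in> S \<longleftrightarrow> (\<forall>j. \<bar>q $ j - e $ j\<bar> \<le> a)" for q
    by (auto simp: S_def mem_box_cart abs_le_iff algebra_simps)
  \<comment> \<open>A Newton step with the derivative at \<open>\<epsilon> = \<phi> = 0\<close>, which is \<open>diag (2, -1, \<dots>, -1)\<close>.\<close>
  define f where "f q = (\<chi> j. if j = first_site
      then q $ j - (q $ j ^ 3 - (1 + \<phi>) * q $ j - \<epsilon> * lap q $ j) / 2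
      else q $ j ^ 3 - \<phi> * q $ j - \<epsilon> * lap q $ j)" for q :: "'n rvec"
  have dist_S: "norm (q - e) \<le> 1/8" if "q \<in> S" for q
    using norm_le_card_cart[of "q - e" a] that a(5) by (simp add: S N_eq)
  have "continuous_on S f"
    unfolding f_def
  proof (rule continuous_on_vec_lambda)
    fix j :: 'n
    have "continuous_on S (\<lambda>q. lap q $ j)"
      by (intro continuous_on_component linear_continuous_on) (simp add: lap_linear flip: linear_conv_bounded_linear)
    then show "continuous_on S (\<lambda>q. if j = first_site
      then q $ j - (q $ j ^ 3 - (1 + \<phi>) * q $ j - \<epsilon> * lap q $ j) / 2
      else q $ j ^ 3 - \<phi> * q $ j - \<epsilon> * lap q $ j)"
      by (cases "j = first_site") (auto intro!: continuous_intros)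
  qed
  moreover have "f \<in> S \<rightarrow> S"
  proof
    fix q assume q: "q \<in> S"
    have "norm e = 1" by (simp add: e_def norm_axis_1)
    then have "norm q \<le> 2" using dist_S[OF q] norm_triangle_ineq2[of q e] by linarith
    then have l: "\<bar>\<epsilon> * lap q $ j\<bar> \<le> 8 * \<epsilon>" for j
      using lap_scaled_bound[of q j] mult_left_mono[of "norm q" 2 "4 * \<epsilon>"] \<epsilon>_pos by linarith
    have "\<bar>f q $ j - e $ j\<bar> \<le> a" for j
    proof (cases "j = first_site")
      case True
      define u where "u = q $ j - 1"
      have u: "\<bar>u\<bar> \<le> a" using S[of q, THEN iffD1, OF q, rule_format, of j] True by (simp add: u_def e_def axis_def)
      have qu: "q $ j = 1 + u" by (simp add: u_def)
      \<comment> \<open>The terms linear in \<open>u\<close> alone cancel, 2 being the derivative of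
        \<open>q ^ 3 - q\<close> at 1. What is left is quadratic in \<open>u\<close> or small with
        the parameters.\<close>
      have "f q $ j - e $ j = - (u * u * (3 + u)) / 2 + (\<phi> * q $ j) / 2 + (\<epsilon> * lap q $ j) / 2"
        using True by (simp add: f_def e_def qu[unfolded True] field_simps power3_eq_cube)
      moreover have "\<bar>u * u * (3 + u)\<bar> \<le> a * (1/16) * 4"
        unfolding abs_mult using u a by (intro mult_mono) auto
      moreover have "\<bar>\<phi> * q $ j\<bar> \<le> \<bar>\<phi>\<bar> * 2"
        unfolding abs_mult using u a by (intro mult_left_mono) (auto simp: qu)
      ultimately show ?thesis using l[of j] a \<epsilon>_pos by linarith
    next
      case False
      then have u: "\<bar>q $ j\<bar> \<le> a"
        using S[of q, THEN iffD1, OF q, rule_format, of j] by (simp add: e_def axis_def)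
      have "f q $ j - e $ j = q $ j * q $ j * q $ j - \<phi> * q $ j - \<epsilon> * lap q $ j"
        using False by (simp add: f_def e_def axis_def power3_eq_cube)
      moreover have "\<bar>q $ j * q $ j * q $ j\<bar> \<le> a * (1/16) * 1"
        unfolding abs_mult using u a by (intro mult_mono) auto
      moreover have "\<bar>\<phi> * q $ j\<bar> \<le> \<bar>\<phi>\<bar> * 1"
        unfolding abs_mult using u a by (intro mult_left_mono) auto
      ultimately show ?thesis using l[of j] a \<epsilon>_pos by linarith
    qed
    then show "f q \<in> S" by (simp add: S)
  qed
  moreover have "e \<in> S" using a by (simp add: S)
  ultimately obtain q where q: "q \<in> S" "f q = q"
    using brouwer[of S f] by (auto simp: S_def convex_box)
  have "dist q e < 1/4" using dist_S[OF q(1)] by (simp add: dist_norm)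
  moreover have "stationary \<epsilon> \<phi> q"
    unfolding stationary_def
  proof
    fix j
    have "f q $ j = q $ j" by (simp add: q(2))
    then show "- \<epsilon> * lap q $ j - (1 + \<phi>) * q $ j + q $ j ^ 3 = 0"
      by (cases "j = first_site") (auto simp: f_def algebra_simps)
  qed
  ultimately show ?thesis unfolding e_def by blast
qed

lemma p_ball: "dist p (axis first_site 1) < 1/4" and p_stationary: "stationary \<epsilon> \<phi> p"
proof -
  have "\<exists>!q. dist q (axis first_site 1 :: 'n rvec) < 1/4 \<and> stationary \<epsilon> \<phi> q"
    using stationary_exists stationary_unique by blast
  from theI'[OF this] show "dist p (axis first_site 1) < 1/4" "stationary \<epsilon> \<phi> p"
    by (auto simp: p_eq breather_def)
qed

section \<open>Concentration of \<open>p\<close> and \<open>x\<close> at the first site\<close>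

lemmas p_components = ball_components[OF p_ball]

lemma norm_p: "norm p \<le> 2"
  using p_ball norm_triangle_ineq2[of p "axis first_site 1"] by (simp add: dist_norm norm_axis_1)

lemma p_square: "j \<noteq> first_site \<Longrightarrow> (p $ j)\<^sup>2 \<le> 1/16"
  using power_mono[of "\<bar>p $ j\<bar>" "1/4" 2] p_components(3)[of j] by (simp add: power2_eq_square)

text \<open>Away from the first site the coefficient \<open>(p $ j)\<^sup>2 - (1 + \<phi>)\<close>
  is close to -1, and the only source in the equation is the coupling to the neighbours.\<close>

lemma p_tail:
  assumes "j \<noteq> first_site"
  shows "\<bar>p $ j\<bar> \<le> 16 * \<epsilon>"
proof -
  have "((p $ j)\<^sup>2 - (1 + \<phi>)) * p $ j = \<epsilon> * lap p $ j + 0"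
    using p_stationary by (simp add: stationary_def power2_eq_square power3_eq_cube algebra_simps)
  then have "\<bar>p $ j\<bar> \<le> 2 * \<bar>0\<bar> + 8 * \<epsilon> * norm p"
    by (rule dominant_component) (use p_square[OF assms] \<phi>_small in auto)
  also have "\<dots> \<le> 16 * \<epsilon>" using norm_p \<epsilon>_pos mult_left_mono[of "norm p" 2 "8 * \<epsilon>"] by simp
  finally show ?thesis .
qed

definition "diag_B j = 3 * (p $ j)\<^sup>2 - (1 + \<phi>)"

lemma diag_B: "1/2 \<le> \<bar>diag_B j\<bar>"
proof (cases "j = first_site")
  case True
  have "(3/4)\<^sup>2 \<le> (p $ j)\<^sup>2" using p_components(1) True by (intro power_mono) auto
  then show ?thesis using \<phi>_small by (simp add: diag_B_def power2_eq_square)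
next
  case False
  then show ?thesis using p_square[OF False] \<phi>_small by (simp add: diag_B_def)
qed

lemma B_op_nth: "B_op \<epsilon> \<phi> w $ j = diag_B j * w $ j - \<epsilon> * lap w $ j"
  by (simp add: B_op_def diag_B_def algebra_simps flip: p_eq)

lemma A_op_linear: "linear (A_op \<epsilon> \<phi> :: 'n rvec \<Rightarrow> 'n rvec)"
  and B_op_linear: "linear (B_op \<epsilon> \<phi> :: 'n rvec \<Rightarrow> 'n rvec)"
  unfolding A_op_def B_op_def
  by (auto intro!: linearI simp: vec_eq_iff linear_add[OF lap_linear] linear_scale[OF lap_linear] algebra_simps)

lemma A_op_p: "A_op \<epsilon> \<phi> p = 0"
  using p_stationary
  by (simp add: A_op_def vec_eq_iff stationary_def power2_eq_square power3_eq_cube algebra_simps flip: p_eq)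

text \<open>Diagonal dominance makes \<open>B_op\<close> injective, hence surjective in finite
  dimension, so that the \<open>inv\<close> in \<open>B_inv_p\<close> is a true inverse.\<close>

lemma B_op_x: "B_op \<epsilon> \<phi> x = p"
proof -
  have "w = 0" if "B_op \<epsilon> \<phi> w = 0" for w :: "'n rvec"
  proof (rule dominant_zero[of diag_B])
    show "diag_B j * w $ j = \<epsilon> * lap w $ j" for j
      using B_op_nth[of w j] that by simp
  qed (rule diag_B)
  then have "inj (B_op \<epsilon> \<phi> :: 'n rvec \<Rightarrow> 'n rvec)"
    by (simp add: linear_injective_0[OF B_op_linear])
  then have "surj (B_op \<epsilon> \<phi> :: 'n rvec \<Rightarrow> 'n rvec)"
    by (rule linear_inj_imp_surj[OF B_op_linear])
  then show ?thesis by (simp add: x_eq p_eq B_inv_p_def surj_f_inv_f)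
qed

lemma inner_mult_swap: "u \<bullet> (\<chi> j. c j * w $ j) = (\<chi> j. c j * u $ j) \<bullet> (w :: 'n rvec)"
  by (simp add: inner_vec_def mult_ac)

lemma A_op_self_adjoint: "u \<bullet> A_op \<epsilon> \<phi> w = A_op \<epsilon> \<phi> u \<bullet> w"
  and B_op_self_adjoint: "u \<bullet> B_op \<epsilon> \<phi> w = B_op \<epsilon> \<phi> u \<bullet> w" for u w :: "'n rvec"
proof -
  define c where "c j = (breather \<epsilon> \<phi> :: 'n rvec) $ j" for j
  have A: "A_op \<epsilon> \<phi> w = \<epsilon> *\<^sub>R lap w + (\<chi> j. (1 + \<phi> - (c j)\<^sup>2) * w $ j)"
    and B: "B_op \<epsilon> \<phi> w = - \<epsilon> *\<^sub>R lap w + (\<chi> j. (- (1 + \<phi>) + 3 * (c j)\<^sup>2) * w $ j)" for w :: "'n rvec"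
    by (simp_all add: A_op_def B_op_def vec_eq_iff c_def algebra_simps)
  show "u \<bullet> A_op \<epsilon> \<phi> w = A_op \<epsilon> \<phi> u \<bullet> w" "u \<bullet> B_op \<epsilon> \<phi> w = B_op \<epsilon> \<phi> u \<bullet> w"
    unfolding A B by (simp_all only: inner_add_right inner_add_left inner_mult_swap inner_scaleR_left
        inner_scaleR_right lap_self_adjoint[OF card])
qed

lemma x_component: "\<bar>x $ j\<bar> \<le> 2 * \<bar>p $ j\<bar> + 8 * \<epsilon> * norm x"
  using dominant_component[of "diag_B j" x j "p $ j"] diag_B[of j] B_op_nth[of x j] B_op_x by simp

lemma norm_x: "norm x \<le> 8 * N"
proof -
  have "norm x \<le> real CARD('n) * (4 + 8 * \<epsilon> * norm x)"
  proof (rule norm_le_card_cart)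
    show "\<bar>x $ j\<bar> \<le> 4 + 8 * \<epsilon> * norm x" for j
      using x_component[of j] component_le_norm_cart[of p j] norm_p by linarith
  qed
  moreover have "8 * N * \<epsilon> * norm x \<le> 1/2 * norm x"
    using \<epsilon>_less by (intro mult_right_mono) auto
  ultimately show ?thesis by (simp add: N_eq algebra_simps)
qed

lemma x_tail:
  assumes "j \<noteq> first_site"
  shows "\<bar>x $ j\<bar> \<le> 100 * N * \<epsilon>"
proof -
  have "\<bar>x $ j\<bar> \<le> 2 * (16 * \<epsilon>) + 8 * \<epsilon> * (8 * N)"
    using x_component[of j] p_tail[OF assms] mult_left_mono[OF norm_x, of "8 * \<epsilon>"] \<epsilon>_pos by linarith
  also have "\<dots> \<le> 100 * N * \<epsilon>"
    using mult_right_mono[OF N_ge, of \<epsilon>] \<epsilon>_pos by (simp add: algebra_simps)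
  finally show ?thesis .
qed

text \<open>At the first site the diagonal entry of \<open>B_op\<close> is positive and at most 5,
  the source \<open>p\<close> exceeds 3/4, and the coupling takes away at most 1/4.\<close>

lemma x_first: "1/10 \<le> x $ first_site"
proof -
  define d where "d = diag_B (first_site :: 'n)"
  have sq: "(3/4)\<^sup>2 \<le> (p $ first_site)\<^sup>2" "(p $ first_site)\<^sup>2 \<le> (5/4)\<^sup>2"
    using p_components(1,2) by (intro power_mono; simp)+
  then have d: "0 < d" "d \<le> 5" using \<phi>_small by (auto simp: d_def diag_B_def power2_eq_square)
  have "d * x $ first_site = p $ first_site + \<epsilon> * lap x $ first_site"
    using B_op_nth[of x first_site] B_op_x by (simp add: d_def)
  moreover have "4 * \<epsilon> * norm x \<le> 1/4"
  proof -
    have "4 * \<epsilon> * norm x \<le> 4 * \<epsilon> * (8 * N)" using norm_x \<epsilon>_pos by (intro mult_left_mono) auto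
    also have "\<dots> = 32/200 * (200 * N * \<epsilon>)" by simp
    also have "\<dots> \<le> 1/4" using \<epsilon>_less by linarith
    finally show ?thesis .
  qed
  ultimately have "1/2 \<le> d * x $ first_site"
    using lap_scaled_bound[of x first_site] p_components(1) by linarith
  moreover have "0 < x $ first_site"
    using calculation d(1) by (meson zero_less_mult_pos less_le_trans half_gt_zero_iff zero_less_one)
  moreover have "d * x $ first_site \<le> 5 * x $ first_site"
    using d(2) calculation(2) by (intro mult_right_mono) auto
  ultimately show ?thesis by linarith
qed

text \<open>The first site contributes at least 3/40, all others together at most 1/25 in absolute
  value. The bound keeps the normalisation of \<open>n1\<close> and \<open>n2\<close> under control
  uniformly in \<open>\<epsilon>\<close>.\<close>

lemma inner_px: "1/40 \<le> x \<bullet> p"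
proof -
  have "x \<bullet> p = x $ first_site * p $ first_site + (\<Sum>j\<in>UNIV - {first_site}. x $ j * p $ j)"
    by (simp add: inner_vec_def sum.remove[where x = first_site])
  moreover have "1/10 * (3/4) \<le> x $ first_site * p $ first_site"
    using x_first p_components(1) by (intro mult_mono) auto
  moreover have "\<bar>\<Sum>j\<in>UNIV - {first_site}. x $ j * p $ j\<bar> \<le> 1/25"
  proof -
    have "\<bar>x $ j * p $ j\<bar> \<le> (100 * N * \<epsilon>) * (16 * \<epsilon>)" if "j \<in> UNIV - {first_site}" for j
      unfolding abs_mult using that x_tail[of j] p_tail[of j] N_ge \<epsilon>_pos by (intro mult_mono) auto
    then have "\<bar>\<Sum>j\<in>UNIV - {first_site}. x $ j * p $ j\<bar> \<le> (\<Sum>j\<in>UNIV - {first_site :: 'n}. (100 * N * \<epsilon>) * (16 * \<epsilon>))"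
      by (intro order_trans[OF sum_abs] sum_mono)
    also have "\<dots> \<le> (\<Sum>j\<in>(UNIV :: 'n set). (100 * N * \<epsilon>) * (16 * \<epsilon>))"
      using N_ge \<epsilon>_pos by (intro sum_mono2) auto
    also have "\<dots> = 1600 * ((N * \<epsilon>) * (N * \<epsilon>))" by (simp add: N_eq)
    also have "\<dots> \<le> 1600 * (1/200 * (1/200))"
      using \<epsilon>_less \<epsilon>_pos N_ge by (intro mult_left_mono mult_mono) auto
    finally show ?thesis by simp
  qed
  ultimately show ?thesis by linarith
qed

text \<open>\<open>u\<close> and \<open>c *\<^sub>R w\<close> agree at the first site and are both
  small elsewhere, so \<open>u\<close> is close to a vector orthogonal to \<open>y\<close>. It is
  applied to \<open>p\<close> and \<open>x\<close>, which are almost parallel.\<close>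

lemma near_orthogonal:
  assumes "u $ first_site = c * w $ first_site"
    and "\<And>j. j \<noteq> first_site \<Longrightarrow> \<bar>u $ j\<bar> \<le> a" "\<And>j. j \<noteq> first_site \<Longrightarrow> \<bar>w $ j\<bar> \<le> b"
    and "w \<bullet> y = 0" "0 \<le> a" "0 \<le> b"
  shows "\<bar>u \<bullet> y\<bar> \<le> N * (a + \<bar>c\<bar> * b) * norm (y :: 'n rvec)"
proof -
  have "norm (u - c *\<^sub>R w) \<le> real CARD('n) * (a + \<bar>c\<bar> * b)"
  proof (rule norm_le_card_cart)
    fix j
    show "\<bar>(u - c *\<^sub>R w) $ j\<bar> \<le> a + \<bar>c\<bar> * b"
    proof (cases "j = first_site")
      case True
      then show ?thesis using assms by simp
    next
      case False
      have "\<bar>c * w $ j\<bar> \<le> \<bar>c\<bar> * b" using assms(3)[OF False] by (simp add: abs_mult mult_left_mono)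
      then show ?thesis using assms(2)[OF False] by simp
    qed
  qed
  moreover have "u \<bullet> y = (u - c *\<^sub>R w) \<bullet> y" using assms(4) by (simp add: inner_diff_left)
  ultimately show ?thesis
    using Cauchy_Schwarz_ineq2[of "u - c *\<^sub>R w" y] mult_right_mono[of _ _ "norm y"]
    by (metis N_eq norm_ge_zero order_trans)
qed

lemma p_near_orthogonal:
  assumes "x \<bullet> y = 0"
  shows "\<bar>p \<bullet> y\<bar> \<le> 1400 * N\<^sup>2 * \<epsilon> * norm y"
proof -
  define c where "c = p $ first_site / x $ first_site"
  have c: "0 \<le> c" "c \<le> 25/2" using x_first p_components(1,2) by (auto simp: c_def field_simps)
  have "\<bar>p \<bullet> y\<bar> \<le> N * (16 * \<epsilon> + \<bar>c\<bar> * (100 * N * \<epsilon>)) * norm y"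
    using assms x_first p_tail x_tail N_ge \<epsilon>_pos by (intro near_orthogonal) (auto simp: c_def)
  also have "\<dots> \<le> N * (16 * (N * \<epsilon>) + 25/2 * (100 * N * \<epsilon>)) * norm y"
    using c N_ge \<epsilon>_pos by (intro mult_right_mono mult_left_mono add_mono) auto
  also have "\<dots> \<le> 1400 * N\<^sup>2 * \<epsilon> * norm y"
    using N_ge \<epsilon>_pos by (simp add: power2_eq_square algebra_simps)
  finally show ?thesis .
qed

lemma x_near_orthogonal:
  assumes "p \<bullet> y = 0"
  shows "\<bar>x \<bullet> y\<bar> \<le> 1400 * N\<^sup>2 * \<epsilon> * norm y"
proof -
  define c where "c = x $ first_site / p $ first_site"
  have "x $ first_site \<le> 8 * N" using component_le_norm_cart[of x first_site] norm_x by linarith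
  moreover have "8 * N * 1 \<le> 8 * N * (p $ first_site * 2)"
    using p_components(1) N_ge by (intro mult_left_mono) auto
  ultimately have "x $ first_site \<le> 16 * N * p $ first_site" by simp
  then have c: "0 \<le> c" "c \<le> 16 * N"
    using x_first p_components(1) by (auto simp: c_def pos_divide_le_eq)
  have "\<bar>x \<bullet> y\<bar> \<le> N * (100 * N * \<epsilon> + \<bar>c\<bar> * (16 * \<epsilon>)) * norm y"
    using assms p_components(1) p_tail x_tail N_ge \<epsilon>_pos by (intro near_orthogonal) (auto simp: c_def)
  also have "\<dots> \<le> N * (100 * N * \<epsilon> + 16 * N * (16 * \<epsilon>)) * norm y"
    using c N_ge \<epsilon>_pos by (intro mult_right_mono mult_left_mono add_mono) auto
  also have "\<dots> \<le> 1400 * N\<^sup>2 * \<epsilon> * norm y"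
    using N_ge \<epsilon>_pos by (simp add: power2_eq_square algebra_simps)
  finally show ?thesis .
qed

end

section \<open>The spectral projection\<close>

text \<open>The damping part: \<open>L_op\<close> is the undamped operator minus
  \<open>D_op\<close>.\<close>

definition D_op :: "real \<Rightarrow> real \<Rightarrow> 'n::{finite,linorder} phase \<Rightarrow> 'n phase"
  where "D_op \<epsilon> \<gamma> w = (C_op \<epsilon> \<gamma> (fst w), C_op \<epsilon> \<gamma> (snd w))"

lemma C_op_axis: "C_op \<epsilon> \<gamma> w = axis last_site (\<gamma> * \<epsilon> * w $ last_site)"
  by (auto simp: C_op_def axis_def vec_eq_iff)

lemma C_op_linear: "linear (C_op \<epsilon> \<gamma>)"
  by (rule linearI) (auto simp: C_op_def vec_eq_iff algebra_simps)

lemma D_op_linear: "linear (D_op \<epsilon> \<gamma>)"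
  by (rule linearI) (auto simp: D_op_def linear_add[OF C_op_linear] linear_scale[OF C_op_linear])

lemma P_op_linear: "linear (P_op \<epsilon> \<phi>)"
  unfolding P_op_def by (rule linearI) (auto simp: inner_add_right algebra_simps)

lemma semigroup_L_eq_expL: "semigroup_L \<epsilon> \<gamma> \<phi> t w = expL (L_op \<epsilon> \<gamma> \<phi>) t w"
  by (simp add: semigroup_L_def expL_def)

locale damped_parameters = small_parameters \<epsilon> \<phi> p x N
  for \<epsilon> \<phi> :: real and p x :: "'n::{finite,linorder} rvec" and N :: real +
  fixes \<gamma> :: real
  assumes \<gamma>_pos: "0 < \<gamma>"
begin

abbreviation "V1 \<equiv> v1 \<epsilon> \<phi> :: 'n phase"
abbreviation "V2 \<equiv> v2 \<epsilon> \<phi> :: 'n phase"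
abbreviation "N1 \<equiv> n1 \<epsilon> \<phi> :: 'n phase"
abbreviation "N2 \<equiv> n2 \<epsilon> \<phi> :: 'n phase"
abbreviation "P \<equiv> P_op \<epsilon> \<phi> :: 'n phase \<Rightarrow> 'n phase"
abbreviation "L \<equiv> L_op \<epsilon> \<gamma> \<phi> :: 'n phase \<Rightarrow> 'n phase"
abbreviation "D \<equiv> D_op \<epsilon> \<gamma> :: 'n phase \<Rightarrow> 'n phase"

lemma norm_components: "norm (fst w) \<le> norm w" "norm (snd w) \<le> norm w" for w :: "'n phase"
  by (metis norm_fst_le norm_snd_le prod.collapse)+

text \<open>The common value of the two normalising constants of \<open>n1\<close> and
  \<open>n2\<close>.\<close>

definition "k = 1 / (x \<bullet> p)"

lemma k: "0 < k" "k \<le> 40" "k * (x \<bullet> p) = 1"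
  using inner_px by (auto simp: k_def field_simps)

lemma V_eq: "V1 = (0, p)" "V2 = (x, 0)"
  by (simp_all add: v1_def v2_def p_eq x_eq)

lemma N_eqs: "N1 = k *\<^sub>R (0, x)" "N2 = k *\<^sub>R (p, 0)"
  by (simp_all add: n1_def n2_def v1_def v2_def k_def inner_commute flip: p_eq x_eq)

lemma dual: "N1 \<bullet> V1 = 1" "N1 \<bullet> V2 = 0" "N2 \<bullet> V1 = 0" "N2 \<bullet> V2 = 1"
  using k(3) by (simp_all add: N_eqs V_eq inner_commute)

lemma P_idem: "P (P w) = P w"
  by (simp add: P_op_def inner_diff_right dual)

lemma range_P:
  assumes "w \<in> range P"
  shows "P w = w" "N1 \<bullet> w = 0" "N2 \<bullet> w = 0" "x \<bullet> snd w = 0" "p \<bullet> fst w = 0"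
proof -
  show "P w = w" using assms P_idem by auto
  show n: "N1 \<bullet> w = 0" "N2 \<bullet> w = 0"
    using assms by (auto simp: P_op_def inner_diff_right dual)
  show "x \<bullet> snd w = 0" "p \<bullet> fst w = 0"
    using n k(1) by (cases w; simp add: N_eqs)+
qed

lemma range_P_iff: "w \<in> range P \<longleftrightarrow> P w = w"
  using range_P(1) by (metis rangeI)

lemma L_op_eq: "L w = (A_op \<epsilon> \<phi> (snd w) - C_op \<epsilon> \<gamma> (fst w), B_op \<epsilon> \<phi> (fst w) - C_op \<epsilon> \<gamma> (snd w))"
  by (simp add: L_op_def case_prod_beta)

lemma L_linear: "linear L"
  by (rule linearI) (auto simp: L_op_eq linear_add[OF A_op_linear] linear_add[OF B_op_linear]
      linear_add[OF C_op_linear] linear_scale[OF A_op_linear] linear_scale[OF B_op_linear]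
      linear_scale[OF C_op_linear] scaleR_diff_right)

lemma L_V: "L V1 = - D V1" "L V2 = V1 - D V2"
  by (simp_all add: L_op_eq D_op_def V_eq A_op_p B_op_x linear_0[OF A_op_linear] linear_0[OF B_op_linear]
      linear_0[OF C_op_linear])

text \<open>As \<open>B_op\<close> maps \<open>x\<close> to \<open>p\<close>, \<open>A_op\<close>
  annihilates \<open>p\<close> and both are symmetric, the undamped part of \<open>L\<close> maps
  the range of \<open>P\<close> into itself. Only the damping creates components that
  \<open>P\<close> removes.\<close>

lemma P_L:
  assumes "w \<in> range P"
  shows "P (L w) = L w + (N1 \<bullet> D w) *\<^sub>R V1 + (N2 \<bullet> D w) *\<^sub>R V2"
proof -
  have "x \<bullet> B_op \<epsilon> \<phi> (fst w) = 0" "p \<bullet> A_op \<epsilon> \<phi> (snd w) = 0"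
    using range_P(5)[OF assms] by (simp_all add: B_op_self_adjoint A_op_self_adjoint B_op_x A_op_p)
  then have "N1 \<bullet> L w = - (N1 \<bullet> D w)" "N2 \<bullet> L w = - (N2 \<bullet> D w)"
    by (simp_all add: N_eqs L_op_eq D_op_def inner_diff_right)
  then show ?thesis by (simp add: P_op_def)
qed

lemma tail_last: "\<bar>p $ last_site\<bar> \<le> 100 * N * \<epsilon>" "\<bar>x $ last_site\<bar> \<le> 100 * N * \<epsilon>"
proof -
  have l: "last_site \<noteq> (first_site :: 'n)" using first_neq_last[OF card] by simp
  have "16 * \<epsilon> \<le> 100 * N * \<epsilon>" using N_ge \<epsilon>_pos by (intro mult_right_mono) auto
  then show "\<bar>p $ last_site\<bar> \<le> 100 * N * \<epsilon>" using p_tail[OF l] by linarith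
  show "\<bar>x $ last_site\<bar> \<le> 100 * N * \<epsilon>" by (rule x_tail[OF l])
qed

lemma inner_C_bound:
  assumes "\<bar>u $ last_site\<bar> \<le> 100 * N * \<epsilon>"
  shows "\<bar>u \<bullet> C_op \<epsilon> \<gamma> w\<bar> \<le> 100 * N * \<gamma> * \<epsilon>\<^sup>2 * norm (w :: 'n rvec)"
proof -
  have "\<bar>u \<bullet> C_op \<epsilon> \<gamma> w\<bar> = \<gamma> * \<epsilon> * (\<bar>u $ last_site\<bar> * \<bar>w $ last_site\<bar>)"
    using \<gamma>_pos \<epsilon>_pos by (simp add: C_op_axis inner_axis abs_mult)
  also have "\<dots> \<le> \<gamma> * \<epsilon> * (100 * N * \<epsilon> * norm w)"
    using \<gamma>_pos \<epsilon>_pos N_ge assms component_le_norm_cart[of w last_site]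
    by (intro mult_left_mono mult_mono) auto
  finally show ?thesis by (simp add: power2_eq_square mult_ac)
qed

text \<open>One factor \<open>\<epsilon>\<close> is the strength of the damping, the other the size
  of \<open>p\<close> or \<open>x\<close> at the last site. The number 4000 is 40 from
  \<open>k\<close> times 100 from \<open>tail_last\<close>.\<close>

lemma N_D: "\<bar>N1 \<bullet> D w\<bar> \<le> 4000 * N * \<gamma> * \<epsilon>\<^sup>2 * norm w" "\<bar>N2 \<bullet> D w\<bar> \<le> 4000 * N * \<gamma> * \<epsilon>\<^sup>2 * norm w"
proof -
  have b: "k * \<bar>u \<bullet> C_op \<epsilon> \<gamma> v\<bar> \<le> 4000 * N * \<gamma> * \<epsilon>\<^sup>2 * norm w"
    if "\<bar>u $ last_site\<bar> \<le> 100 * N * \<epsilon>" "norm v \<le> norm w" for u v :: "'n rvec"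
  proof -
    have "100 * N * \<gamma> * \<epsilon>\<^sup>2 * norm v \<le> 100 * N * \<gamma> * \<epsilon>\<^sup>2 * norm w"
      using that(2) N_ge \<gamma>_pos by (intro mult_left_mono) auto
    then have "\<bar>u \<bullet> C_op \<epsilon> \<gamma> v\<bar> \<le> 100 * N * \<gamma> * \<epsilon>\<^sup>2 * norm w"
      using inner_C_bound[OF that(1), of v] by linarith
    then have "k * \<bar>u \<bullet> C_op \<epsilon> \<gamma> v\<bar> \<le> 40 * (100 * N * \<gamma> * \<epsilon>\<^sup>2 * norm w)"
      using k by (intro mult_mono) auto
    then show ?thesis by simp
  qed
  show "\<bar>N1 \<bullet> D w\<bar> \<le> 4000 * N * \<gamma> * \<epsilon>\<^sup>2 * norm w" "\<bar>N2 \<bullet> D w\<bar> \<le> 4000 * N * \<gamma> * \<epsilon>\<^sup>2 * norm w"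
    using b[OF tail_last(2) norm_components(2)[of w]] b[OF tail_last(1) norm_components(1)[of w]] k(1)
    by (simp_all add: N_eqs D_op_def abs_mult)
qed

lemma norm_V: "norm V1 \<le> 8 * N" "norm V2 \<le> 8 * N"
  using norm_p norm_x N_ge by (auto simp: V_eq norm_Pair)

lemma norm_N: "norm N1 \<le> 320 * N" "norm N2 \<le> 320 * N"
proof -
  have "k * norm x \<le> 40 * (8 * N)" "k * norm p \<le> 40 * (8 * N)"
    using k norm_x norm_p N_ge by (intro mult_mono; simp)+
  then show "norm N1 \<le> 320 * N" "norm N2 \<le> 320 * N"
    using k(1) by (simp_all add: N_eqs norm_Pair)
qed

text \<open>The constant majorises \<open>1 + 2 * 320 * 8 = 5121\<close>.\<close>

lemma norm_P: "norm (P w) \<le> 6000 * N\<^sup>2 * norm w"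
proof -
  have "norm ((u \<bullet> w) *\<^sub>R v) \<le> (320 * N * norm w) * (8 * N)"
    if "norm u \<le> 320 * N" "norm v \<le> 8 * N" for u v :: "'n phase"
  proof -
    have "\<bar>u \<bullet> w\<bar> \<le> 320 * N * norm w"
      using Cauchy_Schwarz_ineq2[of u w] mult_right_mono[OF that(1), of "norm w"] by simp
    then show ?thesis
      unfolding norm_scaleR using that(2) N_ge by (intro mult_mono) auto
  qed
  note b = this[OF norm_N(1) norm_V(1)] this[OF norm_N(2) norm_V(2)]
  have "norm (P w) \<le> norm w + 320 * N * norm w * (8 * N) + 320 * N * norm w * (8 * N)"
    using b norm_triangle_ineq4[of "w - (N1 \<bullet> w) *\<^sub>R V1" "(N2 \<bullet> w) *\<^sub>R V2"]
      norm_triangle_ineq4[of w "(N1 \<bullet> w) *\<^sub>R V1"] unfolding P_op_def by linarith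
  moreover have "1 * norm w \<le> N\<^sup>2 * norm w"
    using N_ge by (intro mult_right_mono) (auto simp: power2_eq_square intro: order_trans[OF _ mult_mono[of 1 N 1 N]])
  ultimately show ?thesis using zero_le_mult_iff[of "N\<^sup>2" "norm w"] by (simp add: power2_eq_square algebra_simps)
qed

lemma norm_P_D_V: "norm (P (D V1)) \<le> 600000 * N ^ 3 * \<gamma> * \<epsilon>\<^sup>2" "norm (P (D V2)) \<le> 600000 * N ^ 3 * \<gamma> * \<epsilon>\<^sup>2"
proof -
  have "norm (C_op \<epsilon> \<gamma> u) \<le> 100 * N * \<gamma> * \<epsilon>\<^sup>2" if "\<bar>u $ last_site\<bar> \<le> 100 * N * \<epsilon>" for u :: "'n rvec"
  proof -
    have "norm (C_op \<epsilon> \<gamma> u) = \<gamma> * \<epsilon> * \<bar>u $ last_site\<bar>"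
      using \<gamma>_pos \<epsilon>_pos by (simp add: C_op_axis norm_eq_sqrt_inner inner_axis_axis abs_mult)
    also have "\<dots> \<le> \<gamma> * \<epsilon> * (100 * N * \<epsilon>)" using that \<gamma>_pos \<epsilon>_pos by (intro mult_left_mono) auto
    finally show ?thesis by (simp add: power2_eq_square mult_ac)
  qed
  then have "norm (D V1) \<le> 100 * N * \<gamma> * \<epsilon>\<^sup>2" "norm (D V2) \<le> 100 * N * \<gamma> * \<epsilon>\<^sup>2"
    using tail_last by (simp_all add: D_op_def V_eq norm_Pair linear_0[OF C_op_linear])
  then have "6000 * N\<^sup>2 * norm (D V1) \<le> 6000 * N\<^sup>2 * (100 * N * \<gamma> * \<epsilon>\<^sup>2)"
    "6000 * N\<^sup>2 * norm (D V2) \<le> 6000 * N\<^sup>2 * (100 * N * \<gamma> * \<epsilon>\<^sup>2)"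
    by (intro mult_left_mono; simp)+
  moreover have "6000 * N\<^sup>2 * (100 * N * \<gamma> * \<epsilon>\<^sup>2) = 600000 * N ^ 3 * \<gamma> * \<epsilon>\<^sup>2"
    by (simp add: power2_eq_square power3_eq_cube)
  ultimately show "norm (P (D V1)) \<le> 600000 * N ^ 3 * \<gamma> * \<epsilon>\<^sup>2" "norm (P (D V2)) \<le> 600000 * N ^ 3 * \<gamma> * \<epsilon>\<^sup>2"
    using norm_P[of "D V1"] norm_P[of "D V2"] by linarith+
qed

text \<open>Vectors in the range are orthogonal to \<open>(0, x)\<close> and \<open>(p, 0)\<close>,
  which are almost parallel to \<open>V1 = (0, p)\<close> and \<open>V2 = (x, 0)\<close>.\<close>

lemma range_P_V:
  assumes "w \<in> range P"
  shows "\<bar>w \<bullet> V1\<bar> \<le> 1400 * N\<^sup>2 * \<epsilon> * norm w" "\<bar>w \<bullet> V2\<bar> \<le> 1400 * N\<^sup>2 * \<epsilon> * norm w"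
proof -
  have "1400 * N\<^sup>2 * \<epsilon> * norm (snd w) \<le> 1400 * N\<^sup>2 * \<epsilon> * norm w"
    "1400 * N\<^sup>2 * \<epsilon> * norm (fst w) \<le> 1400 * N\<^sup>2 * \<epsilon> * norm w"
    using norm_components(2)[of w] norm_components(1)[of w] \<epsilon>_pos by (intro mult_left_mono; simp)+
  then show "\<bar>w \<bullet> V1\<bar> \<le> 1400 * N\<^sup>2 * \<epsilon> * norm w" "\<bar>w \<bullet> V2\<bar> \<le> 1400 * N\<^sup>2 * \<epsilon> * norm w"
    using p_near_orthogonal[OF range_P(4)[OF assms]] x_near_orthogonal[OF range_P(5)[OF assms]]
    by (cases w; simp add: V_eq inner_commute)+
qed

lemma subspace_range_P: "subspace (range P)"
  by (rule linear_subspace_image[OF P_op_linear subspace_UNIV])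

text \<open>\<open>P (\<zeta> t) - \<zeta> t\<close> has derivative zero and vanishes at time
  0.\<close>

lemma range_P_invariant:
  fixes \<zeta> :: "real \<Rightarrow> 'n phase"
  assumes "\<zeta> 0 \<in> range P"
    and "\<And>t. t \<in> {0..T} \<Longrightarrow> (\<zeta> has_vector_derivative f t) (at t within {0..T})"
    and "\<And>t. t \<in> {0..T} \<Longrightarrow> f t \<in> range P"
    and t: "t \<in> {0..T}"
  shows "\<zeta> t \<in> range P"
proof -
  have bl: "bounded_linear (\<lambda>w. P w - w)"
    using P_op_linear[of \<epsilon> \<phi>] by (intro bounded_linear_sub bounded_linear_ident)
      (simp add: linear_conv_bounded_linear)
  have "((\<lambda>t. P (\<zeta> t) - \<zeta> t) has_vector_derivative 0) (at s within {0..T})" if "s \<in> {0..T}" for s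
    using bounded_linear.has_vector_derivative[OF bl assms(2)[OF that]] range_P(1)[OF assms(3)[OF that]]
    by simp
  then have "norm ((P (\<zeta> t) - \<zeta> t) - (P (\<zeta> 0) - \<zeta> 0)) \<le> 0 * t"
    using t by (intro increment_bound) auto
  then show ?thesis using range_P(1)[OF assms(1)] by (simp add: range_P_iff)
qed

end

section \<open>A priori bounds\<close>

text \<open>\<open>c0\<close> is the rescaled time \<open>T * \<epsilon>\<close>. \<open>k1\<close>
  bounds the velocity of \<open>s\<close> and \<open>k2\<close> the deviation of that of
  \<open>\<delta>\<close> from its drift, \<open>k3\<close> and \<open>k4\<close> bound the forcing
  of \<open>\<zeta>\<close> before and after projection, and \<open>k5\<close> collects all errors
  in \<open>\<zeta>\<close> up to time \<open>T\<close>. The choice \<open>d0 = 4 * c0\<close>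
  leaves room above the drift and its error.\<close>

locale damped_system = damped_parameters \<epsilon> \<phi> p x N \<gamma>
  for \<epsilon> \<phi> :: real and p x :: "'n::{finite,linorder} rvec" and N \<gamma> :: real +
  fixes C \<kappa> K r T :: real and F :: "'n state \<Rightarrow> 'n state" and c0 d0 k1 k2 k3 k4 k5 A c1 :: real
  assumes pos: "0 < C" "0 < \<kappa>" "0 < K" "0 < r"
    and T_eq: "T = 8 * C / (\<kappa> * \<epsilon>)"
    and F: "modulation_system K r \<epsilon> \<gamma> \<phi> F"
    and semigroup: "\<And>t \<zeta>. t \<in> {0..T} \<Longrightarrow> \<zeta> \<in> range P \<Longrightarrow>
      norm (semigroup_L \<epsilon> \<gamma> \<phi> t \<zeta>) \<le> (1 + C * \<gamma>) * exp (- \<kappa> * \<gamma> * \<epsilon> * t) * norm \<zeta>"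
    and c0_eq: "c0 = 8 * C / \<kappa>" and d0_eq: "d0 = 4 * c0" and k1_eq: "k1 = K * (4 * d0 + 20)"
    and k2_eq: "k2 = K * d0 + k1"
    and k3_eq: "k3 = k1 * K * (d0 + 1) + (2 + k2) * K * d0 + 16 * K"
    and k4_eq: "k4 = 6000 * N\<^sup>2 * k3"
    and A_eq: "A = 600000 * N ^ 3" and c1_eq: "c1 = c0\<^sup>2 + 2 * c0"
    and k5_eq: "k5 = 2 * (k4 * c0 + 8 * A\<^sup>2 * c1 * c0) + 22400 * N\<^sup>2 * A * c1"
    and \<epsilon>1: "\<epsilon> \<le> 1" and \<gamma>1: "\<gamma> \<le> 1"
    and small: "k1 * c0 * \<gamma> < 1" "k2 * \<gamma> < 1" "16 * N * A * c1 * \<gamma> < 1" "2 * C * \<gamma> < 1" "k5 * \<gamma> < 1"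
    and small_r: "\<gamma> \<le> r" "d0 * \<gamma> \<le> r" "4 * \<gamma> \<le> r"
begin

text \<open>Up to constants, \<open>\<gamma> * q\<close> is the scale of \<open>\<zeta>\<close>, and
  \<open>\<gamma> * u\<close> is that of \<open>\<delta>\<close> on \<open>{0..T}\<close>.\<close>

definition "q = \<epsilon> ^ CARD('n)"
definition "u = \<epsilon> ^ (2 * CARD('n) - 2)"

lemma const_pos: "0 < c0" "0 < d0" "0 < k1" "0 < k2" "0 < k3" "0 < k4" "0 < A" "0 < c1" "0 < k5"
proof -
  show c0: "0 < c0" using pos by (simp add: c0_eq)
  then show d0: "0 < d0" by (simp add: d0_eq)
  then show k1: "0 < k1" using pos by (simp add: k1_eq)
  then show k2: "0 < k2" using pos d0 by (simp add: k2_eq add_pos_pos)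
  show k3: "0 < k3" using k1 k2 pos d0 by (simp add: k3_eq add_pos_pos)
  then show k4: "0 < k4" using N_ge by (simp add: k4_eq)
  show A: "0 < A" using N_ge by (simp add: A_eq)
  show c1: "0 < c1" using c0 by (simp add: c1_eq add_pos_pos)
  show "0 < k5" using N_ge k4 A c0 c1 by (simp add: k5_eq add_pos_pos)
qed

lemma powers: "0 < q" "0 < u" "u \<le> q" "q \<le> \<epsilon>\<^sup>2" "q * q = u * \<epsilon>\<^sup>2" "\<epsilon> ^ (2 * CARD('n) - 1) = u * \<epsilon>"
  "\<epsilon>\<^sup>2 \<le> \<epsilon>" "q \<le> \<epsilon>" "q \<le> 1" "u \<le> 1"
proof -
  show "0 < q" "0 < u" using \<epsilon>_pos by (simp_all add: q_def u_def)
  show "u \<le> q" using card \<epsilon>_pos \<epsilon>1 by (auto simp: q_def u_def intro!: power_decreasing)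
  show "q \<le> \<epsilon>\<^sup>2" using card \<epsilon>_pos \<epsilon>1 by (auto simp: q_def intro!: power_decreasing)
  have "CARD('n) + CARD('n) = 2 * CARD('n) - 2 + 2" using card by linarith
  then show "q * q = u * \<epsilon>\<^sup>2" unfolding q_def u_def by (simp only: power_add[symmetric])
  have "2 * CARD('n) - 1 = 2 * CARD('n) - 2 + 1" using card by linarith
  then show "\<epsilon> ^ (2 * CARD('n) - 1) = u * \<epsilon>" by (simp add: u_def power_add)
  show "\<epsilon>\<^sup>2 \<le> \<epsilon>" using \<epsilon>_pos \<epsilon>1 by (simp add: power2_eq_square)
  with \<open>q \<le> \<epsilon>\<^sup>2\<close> show "q \<le> \<epsilon>" by simp
  then show "q \<le> 1" using \<epsilon>1 by simp
  with \<open>u \<le> q\<close> show "u \<le> 1" by simp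
qed

lemma T: "0 < T" "T * \<epsilon> = c0"
  using pos \<epsilon>_pos by (simp_all add: T_eq c0_eq)

text \<open>For states of the expected size, everything besides the drift of \<open>\<delta>\<close>
  and the linear part of \<open>\<zeta>\<close> is quadratic in \<open>\<gamma> * q\<close>, because
  \<open>u \<le> q\<close>.\<close>

lemma field_bounds:
  assumes "(s, \<delta>, \<zeta>) \<in> state_nbhd r \<epsilon> \<phi>"
    and \<delta>: "\<bar>\<delta>\<bar> \<le> d0 * \<gamma> * u" and \<zeta>: "norm \<zeta> \<le> 4 * \<gamma> * q"
  shows "\<bar>fst (F (s, \<delta>, \<zeta>))\<bar> \<le> k1 * \<gamma>\<^sup>2 * (q * q)" (is ?s)
    and "\<bar>fst (snd (F (s, \<delta>, \<zeta>))) + 2 * \<gamma> * u * \<epsilon>\<bar> \<le> k2 * \<gamma>\<^sup>2 * (q * q)" (is ?\<delta>)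
    and "\<exists>G\<in>range P. snd (snd (F (s, \<delta>, \<zeta>))) = P (L \<zeta>) + G \<and> norm G \<le> k4 * \<gamma>\<^sup>2 * (q * q)" (is ?\<zeta>)
proof -
  obtain a1 a2 b0 b1 b2 u1 u2 u3 ds d\<delta> where
    a: "\<bar>a1\<bar> \<le> K * (\<bar>\<delta>\<bar> + \<gamma> * q)" "\<bar>a2\<bar> \<le> K * (norm \<zeta>)\<^sup>2"
    and b: "\<bar>b0\<bar> \<le> K * \<bar>\<delta>\<bar>" "\<bar>b1\<bar> \<le> K * (\<bar>\<delta>\<bar> + \<gamma> * q)" "\<bar>b2\<bar> \<le> K * (norm \<zeta>)\<^sup>2"
    and u: "norm u1 \<le> K * (\<bar>\<delta>\<bar> + \<epsilon>)" "norm u2 \<le> K * \<bar>\<delta>\<bar>" "norm u3 \<le> K * (norm \<zeta>)\<^sup>2"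
    and ds: "ds = a1 * norm \<zeta> + a2"
    and d\<delta>: "d\<delta> = - (2 + b0) * \<gamma> * (u * \<epsilon>) + b1 * norm \<zeta> + b2"
    and F_eq: "F (s, \<delta>, \<zeta>) = (ds, d\<delta>, P (L \<zeta> + ds *\<^sub>R (0, u1) + d\<delta> *\<^sub>R (u2, 0) + u3))"
    using F assms(1) unfolding modulation_system_def powers(6) q_def[symmetric] by fast
  note [simp] = powers(1,2)[THEN less_imp_le] \<epsilon>_pos[THEN less_imp_le] \<gamma>_pos[THEN less_imp_le]
    const_pos[THEN less_imp_le] pos[THEN less_imp_le]
  have \<delta>q: "\<bar>\<delta>\<bar> \<le> d0 * \<gamma> * q"
    using \<delta> mult_left_mono[OF powers(3), of "d0 * \<gamma>"] by simp
  have \<zeta>2: "K * (norm \<zeta>)\<^sup>2 \<le> 16 * K * \<gamma>\<^sup>2 * (q * q)"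
    using mult_left_mono[OF power_mono[OF \<zeta> norm_ge_zero, of 2], of K]
    by (simp add: power2_eq_square mult_ac)
  have coef: "\<bar>c * norm \<zeta>\<bar> \<le> K * (4 * d0 + 4) * \<gamma>\<^sup>2 * (q * q)" if "\<bar>c\<bar> \<le> K * (\<bar>\<delta>\<bar> + \<gamma> * q)" for c
  proof -
    have "\<bar>c\<bar> \<le> K * (d0 * \<gamma> * q + \<gamma> * q)"
      by (rule order_trans[OF that]) (use \<delta>q in \<open>auto intro!: mult_left_mono\<close>)
    then have "\<bar>c\<bar> * norm \<zeta> \<le> K * (d0 * \<gamma> * q + \<gamma> * q) * (4 * \<gamma> * q)"
      using \<zeta> by (intro mult_mono) auto
    then show ?thesis by (simp add: abs_mult power2_eq_square algebra_simps)
  qed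
  have ds_bound: "\<bar>ds\<bar> \<le> k1 * \<gamma>\<^sup>2 * (q * q)"
  proof -
    have "\<bar>ds\<bar> \<le> K * (4 * d0 + 4) * \<gamma>\<^sup>2 * (q * q) + 16 * K * \<gamma>\<^sup>2 * (q * q)"
      using coef[OF a(1)] a(2) \<zeta>2 unfolding ds by linarith
    then show ?thesis by (simp add: k1_eq algebra_simps)
  qed
  then show ?s by (simp add: F_eq)
  \<comment> \<open>This brings the products of \<open>\<delta>\<close> with its own drift to the
    common scale \<open>q * q\<close>.\<close>
  have uu: "u * (u * \<epsilon>) \<le> q * q"
  proof -
    have "u * \<epsilon> \<le> q" using mult_left_mono[OF \<epsilon>1, of u] powers(3) by simp
    then show ?thesis using powers(3) by (intro mult_mono) auto
  qed
  have d\<delta>_bound: "\<bar>d\<delta> + 2 * \<gamma> * u * \<epsilon>\<bar> \<le> k2 * \<gamma>\<^sup>2 * (q * q)"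
  proof -
    have "\<bar>b0 * (\<gamma> * (u * \<epsilon>))\<bar> \<le> K * (d0 * \<gamma> * u) * (\<gamma> * (u * \<epsilon>))"
      unfolding abs_mult using b(1) \<delta> by (intro mult_mono) (auto intro: order_trans[OF _ mult_left_mono])
    also have "\<dots> = K * d0 * \<gamma>\<^sup>2 * (u * (u * \<epsilon>))" by (simp add: power2_eq_square)
    also have "\<dots> \<le> K * d0 * \<gamma>\<^sup>2 * (q * q)" using uu by (intro mult_left_mono) auto
    finally have "\<bar>b0 * (\<gamma> * (u * \<epsilon>))\<bar> \<le> K * d0 * \<gamma>\<^sup>2 * (q * q)" .
    moreover have "d\<delta> + 2 * \<gamma> * u * \<epsilon> = - (b0 * (\<gamma> * (u * \<epsilon>))) + b1 * norm \<zeta> + b2"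
      by (simp add: d\<delta> algebra_simps)
    ultimately have "\<bar>d\<delta> + 2 * \<gamma> * u * \<epsilon>\<bar> \<le> K * d0 * \<gamma>\<^sup>2 * (q * q) + K * (4 * d0 + 4) * \<gamma>\<^sup>2 * (q * q)
        + 16 * K * \<gamma>\<^sup>2 * (q * q)"
      using coef[OF b(2)] b(3) \<zeta>2 by linarith
    then show ?thesis by (simp add: k1_eq k2_eq algebra_simps)
  qed
  then show ?\<delta> by (simp add: F_eq)
  \<comment> \<open>The drift is only of first order in \<open>\<gamma>\<close>; the second factor
    \<open>\<gamma>\<close> comes from \<open>u2\<close>, which is bounded by a multiple of
    \<open>\<delta>\<close>.\<close>
  have "\<bar>d\<delta>\<bar> \<le> (2 + k2) * (\<gamma> * (u * \<epsilon>))"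
  proof -
    have "k2 * \<gamma>\<^sup>2 * (q * q) = k2 * (\<gamma> * (u * \<epsilon>)) * (\<gamma> * \<epsilon>)"
      unfolding powers(5) by (simp add: power2_eq_square)
    also have "\<dots> \<le> k2 * (\<gamma> * (u * \<epsilon>)) * 1"
      using \<epsilon>1 \<gamma>1 by (intro mult_left_mono) (auto intro: mult_le_one)
    finally have "\<bar>d\<delta> + 2 * (\<gamma> * (u * \<epsilon>))\<bar> \<le> k2 * (\<gamma> * (u * \<epsilon>))"
      using d\<delta>_bound by (simp add: mult.assoc)
    moreover have "0 \<le> \<gamma> * (u * \<epsilon>)" by simp
    ultimately show ?thesis unfolding distrib_right by linarith
  qed
  then have "\<bar>d\<delta>\<bar> * norm u2 \<le> (2 + k2) * (\<gamma> * (u * \<epsilon>)) * (K * (d0 * \<gamma> * u))"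
    using u(2) \<delta> by (intro mult_mono) (auto intro: order_trans[OF _ mult_left_mono])
  also have "\<dots> = (2 + k2) * K * d0 * \<gamma>\<^sup>2 * (u * (u * \<epsilon>))" by (simp add: power2_eq_square)
  also have "\<dots> \<le> (2 + k2) * K * d0 * \<gamma>\<^sup>2 * (q * q)" using uu by (intro mult_left_mono) auto
  finally have g2: "\<bar>d\<delta>\<bar> * norm u2 \<le> (2 + k2) * K * d0 * \<gamma>\<^sup>2 * (q * q)" .
  have g1: "\<bar>ds\<bar> * norm u1 \<le> k1 * K * (d0 + 1) * \<gamma>\<^sup>2 * (q * q)"
  proof -
    have "d0 * \<gamma> * q \<le> d0 * 1 * 1" using \<gamma>1 powers(9) by (intro mult_mono) auto
    then have "norm u1 \<le> K * (d0 + 1)"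
      using \<delta>q \<epsilon>1 by (intro order_trans[OF u(1)] mult_left_mono) auto
    then have "\<bar>ds\<bar> * norm u1 \<le> k1 * \<gamma>\<^sup>2 * (q * q) * (K * (d0 + 1))"
      using ds_bound by (intro mult_mono) auto
    then show ?thesis by (simp add: mult_ac)
  qed
  define w where "w = ds *\<^sub>R (0, u1) + d\<delta> *\<^sub>R (u2, 0) + u3"
  have "norm w \<le> \<bar>ds\<bar> * norm u1 + \<bar>d\<delta>\<bar> * norm u2 + norm u3"
    using norm_triangle_ineq[of "ds *\<^sub>R (0, u1) + d\<delta> *\<^sub>R (u2, 0)" u3]
      norm_triangle_ineq[of "ds *\<^sub>R (0 :: 'n rvec, u1)" "d\<delta> *\<^sub>R (u2, 0)"]
    unfolding w_def norm_scaleR by (simp add: norm_Pair)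
  also have "\<dots> \<le> k3 * \<gamma>\<^sup>2 * (q * q)"
    using g1 g2 u(3) \<zeta>2 by (simp add: k3_eq algebra_simps)
  finally have "6000 * N\<^sup>2 * norm w \<le> 6000 * N\<^sup>2 * (k3 * \<gamma>\<^sup>2 * (q * q))" by (intro mult_left_mono) auto
  then have "norm (P w) \<le> k4 * \<gamma>\<^sup>2 * (q * q)"
    using norm_P[of w] unfolding k4_eq by (simp only: mult.assoc)
  moreover have "snd (snd (F (s, \<delta>, \<zeta>))) = P (L \<zeta>) + P w"
    by (simp add: F_eq w_def add.assoc flip: linear_add[OF P_op_linear])
  ultimately show ?\<zeta> by blast
qed

lemma state_nbhdI:
  assumes "\<bar>s\<bar> \<le> \<gamma>" "\<bar>\<delta>\<bar> \<le> d0 * \<gamma> * u" "norm \<zeta> \<le> 4 * \<gamma> * q" "\<zeta> \<in> range P"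
  shows "(s, \<delta>, \<zeta>) \<in> state_nbhd r \<epsilon> \<phi>"
proof -
  have "d0 * \<gamma> * u \<le> d0 * \<gamma>" "4 * \<gamma> * q \<le> 4 * \<gamma>"
    using powers(9,10) const_pos(2) \<gamma>_pos by simp_all
  then show ?thesis using assms small_r unfolding state_nbhd_def by auto
qed

text \<open>The derivative \<open>y'\<close> has to agree with \<open>F\<close> only while
  \<open>y\<close> is in the neighbourhood. Hence the bounds apply to solutions of the system as
  well as to the extended field by which a solution is constructed.\<close>

context
  fixes y y' :: "real \<Rightarrow> 'n state" and \<zeta>0 :: "'n phase"
  assumes init: "y 0 = (0, 0, \<zeta>0)" "norm \<zeta>0 \<le> 2 * \<gamma> * q"
    and range_\<zeta>: "\<And>t. t \<in> {0..T} \<Longrightarrow> snd (snd (y t)) \<in> range P"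
    and deriv: "\<And>t. t \<in> {0..T} \<Longrightarrow> (y has_vector_derivative y' t) (at t within {0..T})"
    and eq: "\<And>t. t \<in> {0..T} \<Longrightarrow> y t \<in> state_nbhd r \<epsilon> \<phi> \<Longrightarrow> y' t = F (y t)"
begin

definition "good t \<longleftrightarrow> \<bar>fst (y t)\<bar> \<le> \<gamma> \<and> \<bar>fst (snd (y t))\<bar> \<le> d0 * \<gamma> * u \<and> norm (snd (snd (y t))) \<le> 4 * \<gamma> * q"

lemma good_nbhd: "t \<in> {0..T} \<Longrightarrow> good t \<Longrightarrow> y t \<in> state_nbhd r \<epsilon> \<phi>"
  using state_nbhdI[of "fst (y t)" "fst (snd (y t))" "snd (snd (y t))"] range_\<zeta> by (simp add: good_def)

lemma good_bounds:
  assumes "t \<in> {0..T}" "good t"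
  shows "\<bar>fst (y' t)\<bar> \<le> k1 * \<gamma>\<^sup>2 * (q * q)"
    and "\<bar>fst (snd (y' t)) + 2 * \<gamma> * u * \<epsilon>\<bar> \<le> k2 * \<gamma>\<^sup>2 * (q * q)"
    and "\<exists>G\<in>range P. snd (snd (y' t)) = P (L (snd (snd (y t)))) + G \<and> norm G \<le> k4 * \<gamma>\<^sup>2 * (q * q)"
  using field_bounds[of "fst (y t)" "fst (snd (y t))" "snd (snd (y t))"] good_nbhd[OF assms] assms(2)
  by (simp_all add: good_def eq[OF assms(1) good_nbhd[OF assms]])

lemma component_deriv:
  assumes "t \<in> {0..T}"
  shows "((\<lambda>t. fst (y t)) has_vector_derivative fst (y' t)) (at t within {0..T})"
    "((\<lambda>t. fst (snd (y t))) has_vector_derivative fst (snd (y' t))) (at t within {0..T})"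
    "((\<lambda>t. snd (snd (y t))) has_vector_derivative snd (snd (y' t))) (at t within {0..T})"
  using bounded_linear.has_vector_derivative[OF bounded_linear_fst deriv[OF assms]]
    bounded_linear.has_vector_derivative[OF bounded_linear_fst
      bounded_linear.has_vector_derivative[OF bounded_linear_snd deriv[OF assms]]]
    bounded_linear.has_vector_derivative[OF bounded_linear_snd
      bounded_linear.has_vector_derivative[OF bounded_linear_snd deriv[OF assms]]]
  by simp_all

text \<open>The first two bounds integrate \<open>good_bounds\<close>; the third is
  \<open>projected_decay\<close> with \<open>S = 4 * \<gamma> * q\<close>.\<close>

lemma bounds_while_good:
  assumes t: "t \<in> {0..T}" and all_good: "\<forall>s\<in>{0..t}. good s"
  shows "\<bar>fst (y t)\<bar> \<le> k1 * \<gamma>\<^sup>2 * (q * q) * t"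
    and "\<bar>fst (snd (y t)) + 2 * \<gamma> * u * \<epsilon> * t\<bar> \<le> k2 * \<gamma>\<^sup>2 * (q * q) * t"
    and "norm (snd (snd (y t))) \<le> (1 + C * \<gamma>) * exp (- \<kappa> * \<gamma> * \<epsilon> * t) * norm \<zeta>0 + k5 * \<gamma> * \<epsilon> * (\<gamma> * q)"
proof -
  note nonneg [simp] = powers(1,2)[THEN less_imp_le] \<epsilon>_pos[THEN less_imp_le] \<gamma>_pos[THEN less_imp_le]
    const_pos[THEN less_imp_le] pos[THEN less_imp_le]
  note good = all_good[rule_format]
  have sub: "s \<in> {0..T}" if "s \<in> {0..t}" for s using t that by auto
  have "norm (fst (y t) - fst (y 0)) \<le> k1 * \<gamma>\<^sup>2 * (q * q) * t"
    using t good_bounds(1)[OF sub good] by (intro increment_bound[OF _ _ component_deriv(1)]) auto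
  then show "\<bar>fst (y t)\<bar> \<le> k1 * \<gamma>\<^sup>2 * (q * q) * t" by (simp add: init)
  \<comment> \<open>The drift is added to \<open>\<delta>\<close>, so that only the quadratic error
    is integrated.\<close>
  have "norm ((fst (snd (y t)) + t *\<^sub>R (2 * \<gamma> * u * \<epsilon>)) - (fst (snd (y 0)) + 0 *\<^sub>R (2 * \<gamma> * u * \<epsilon>)))
      \<le> k2 * \<gamma>\<^sup>2 * (q * q) * t"
  proof (rule increment_bound[where T = T])
    show "((\<lambda>t. fst (snd (y t)) + t *\<^sub>R (2 * \<gamma> * u * \<epsilon>)) has_vector_derivative
        (fst (snd (y' s)) + 2 * \<gamma> * u * \<epsilon>)) (at s within {0..T})" if "s \<in> {0..T}" for s
      by (rule has_vector_derivative_add[OF component_deriv(2)[OF that]])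
        (auto intro!: derivative_eq_intros simp flip: has_real_derivative_iff_has_vector_derivative)
  qed (use t good_bounds(2)[OF sub good] in auto)
  then show "\<bar>fst (snd (y t)) + 2 * \<gamma> * u * \<epsilon> * t\<bar> \<le> k2 * \<gamma>\<^sup>2 * (q * q) * t"
    by (simp add: init mult_ac)
  define \<zeta> where "\<zeta> s = snd (snd (y s))" for s
  have "\<forall>s\<in>{0..t}. \<exists>G. G \<in> range P \<and> snd (snd (y' s)) = P (L (\<zeta> s)) + G \<and> norm G \<le> k4 * \<gamma>\<^sup>2 * (q * q)"
    using good_bounds(3)[OF sub good] unfolding \<zeta>_def by blast
  then obtain G where G: "\<And>s. s \<in> {0..t} \<Longrightarrow> G s \<in> range P"
    "\<And>s. s \<in> {0..t} \<Longrightarrow> snd (snd (y' s)) = P (L (\<zeta> s)) + G s"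
    "\<And>s. s \<in> {0..t} \<Longrightarrow> norm (G s) \<le> k4 * \<gamma>\<^sup>2 * (q * q)"
    by metis
  \<comment> \<open>\<open>\<sigma>\<close> dominates the bounds of \<open>N_D\<close> and
    \<open>norm_P_D_V\<close>. Its two powers of \<open>\<epsilon>\<close> offset the growth in
    time: since \<open>t * \<epsilon> \<le> c0\<close>, \<open>\<tau>\<close> dominates
    \<open>(t\<^sup>2 + 2 * t) * \<sigma>\<close>.\<close>
  define \<sigma> where "\<sigma> = A * \<gamma> * \<epsilon>\<^sup>2"
  define \<tau> where "\<tau> = A * c1 * \<gamma>"
  have t\<epsilon>: "t * \<epsilon> \<le> c0" using t T \<epsilon>_pos mult_right_mono[of t T \<epsilon>] by auto
  have NA: "4000 * N \<le> A"
  proof -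
    have "1 \<le> N\<^sup>2" using N_ge by (intro one_le_power) auto
    then have "4000 * N * 1 \<le> 600000 * N * N\<^sup>2" using N_ge by (intro mult_mono) auto
    then show ?thesis by (simp add: A_eq power2_eq_square power3_eq_cube)
  qed
  have "norm (\<zeta> t) \<le> (1 + C * \<gamma>) * exp (- (\<kappa> * \<gamma> * \<epsilon> * t)) * norm (\<zeta> 0)
      + (1 + C * \<gamma>) * (k4 * \<gamma>\<^sup>2 * (q * q) + 2 * \<sigma> * \<tau> * (4 * \<gamma> * q)) * t
      + 4 * (1400 * N\<^sup>2 * \<epsilon>) * \<tau> * (4 * \<gamma> * q)"
  proof (rule projected_decay[of L D V1 V2 N1 N2 \<sigma> "8 * N" "1400 * N\<^sup>2 * \<epsilon>" t \<tau> "1 + C * \<gamma>" "\<kappa> * \<gamma> * \<epsilon>" \<zeta> G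
        "4 * \<gamma> * q", folded P_op_def])
    show "linear L" "linear D" by (rule L_linear D_op_linear)+
    show "L V1 = - D V1" "L V2 = V1 - D V2" by (rule L_V)+
    show "P (L w) = L w + (N1 \<bullet> D w) *\<^sub>R V1 + (N2 \<bullet> D w) *\<^sub>R V2" if "w \<in> range P" for w
      using that by (rule P_L)
    have "4000 * N * \<gamma> * \<epsilon>\<^sup>2 * norm w \<le> \<sigma> * norm w" for w :: "'n phase"
      unfolding \<sigma>_def using NA by (intro mult_right_mono) auto
    then show "\<bar>N1 \<bullet> D w\<bar> \<le> \<sigma> * norm w" "\<bar>N2 \<bullet> D w\<bar> \<le> \<sigma> * norm w" for w
      using N_D[of w] order_trans by blast+
    show "norm (P (D V1)) \<le> \<sigma>" "norm (P (D V2)) \<le> \<sigma>"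
      using norm_P_D_V by (simp_all add: \<sigma>_def A_eq)
    show "norm V1 \<le> 8 * N" "norm V2 \<le> 8 * N" by (rule norm_V)+
    show "\<bar>w \<bullet> V1\<bar> \<le> 1400 * N\<^sup>2 * \<epsilon> * norm w" "\<bar>w \<bullet> V2\<bar> \<le> 1400 * N\<^sup>2 * \<epsilon> * norm w"
      if "w \<in> range P" for w
      using that by (rule range_P_V)+
    show "(t\<^sup>2 + 2 * t) * \<sigma> \<le> \<tau>"
    proof -
      have "(t * \<epsilon>) * (t * \<epsilon>) \<le> c0 * c0" using t t\<epsilon> by (intro mult_mono) auto
      moreover have "2 * (t * \<epsilon>) * \<epsilon> \<le> 2 * c0 * 1" using t t\<epsilon> \<epsilon>1 by (intro mult_mono) auto
      ultimately have "(t * \<epsilon>) * (t * \<epsilon>) + 2 * (t * \<epsilon>) * \<epsilon> \<le> c1"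
        by (simp add: c1_eq power2_eq_square)
      then have "A * \<gamma> * ((t * \<epsilon>) * (t * \<epsilon>) + 2 * (t * \<epsilon>) * \<epsilon>) \<le> A * \<gamma> * c1"
        by (intro mult_left_mono) auto
      then show ?thesis by (simp add: \<sigma>_def \<tau>_def power2_eq_square algebra_simps)
    qed
    show "8 * N * \<tau> \<le> 1/2" using small(3) by (simp add: \<tau>_def)
    show "norm (expL L s w) \<le> (1 + C * \<gamma>) * exp (- (\<kappa> * \<gamma> * \<epsilon> * s)) * norm w"
      if "s \<in> {0..t}" "w \<in> range P" for s w
      using semigroup[OF sub[OF that(1)] that(2)] by (simp add: semigroup_L_eq_expL)
    show "(\<zeta> has_vector_derivative P (L (\<zeta> s)) + G s) (at s within {0..t})" if "s \<in> {0..t}" for s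
      using has_vector_derivative_within_subset[OF component_deriv(3)[OF sub[OF that]], of "{0..t}"] t
        G(2)[OF that] by (simp add: \<zeta>_def[abs_def])
    show "\<zeta> s \<in> range P" if "s \<in> {0..t}" for s
      using range_\<zeta>[OF sub[OF that]] by (simp add: \<zeta>_def)
    show "norm (\<zeta> s) \<le> 4 * \<gamma> * q" if "s \<in> {0..t}" for s
      using good[OF that] by (simp add: \<zeta>_def good_def)
  qed (use t G N_ge in \<open>auto simp: \<sigma>_def\<close>)
  also have "(1 + C * \<gamma>) * (k4 * \<gamma>\<^sup>2 * (q * q) + 2 * \<sigma> * \<tau> * (4 * \<gamma> * q)) * t
      \<le> 2 * (k4 * c0 + 8 * A\<^sup>2 * c1 * c0) * \<gamma> * \<epsilon> * (\<gamma> * q)"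
  proof -
    have "(k4 * \<gamma>\<^sup>2 * (q * q) + 2 * \<sigma> * \<tau> * (4 * \<gamma> * q)) * t
        \<le> (k4 * c0 + 8 * A\<^sup>2 * c1 * c0) * \<gamma> * \<epsilon> * (\<gamma> * q)"
    proof -
      \<comment> \<open>As \<open>q \<le> \<epsilon>\<^sup>2\<close>, integrating over a time of
        order \<open>1 / \<epsilon>\<close> still leaves one factor
        \<open>\<epsilon>\<close>.\<close>
      have "q * t \<le> \<epsilon>\<^sup>2 * t" using t powers(4) by (intro mult_right_mono) auto
      also have "\<dots> = \<epsilon> * (t * \<epsilon>)" by (simp add: power2_eq_square)
      also have "\<dots> \<le> \<epsilon> * c0" using t\<epsilon> by (intro mult_left_mono) auto
      finally have "k4 * \<gamma>\<^sup>2 * q * (q * t) \<le> k4 * \<gamma>\<^sup>2 * q * (\<epsilon> * c0)" by (intro mult_left_mono) auto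
      moreover have "8 * A\<^sup>2 * c1 * \<gamma>\<^sup>2 * q * \<epsilon> * (\<gamma> * (t * \<epsilon>)) \<le> 8 * A\<^sup>2 * c1 * \<gamma>\<^sup>2 * q * \<epsilon> * (1 * c0)"
        using t\<epsilon> \<gamma>1 t by (intro mult_left_mono mult_mono) auto
      ultimately show ?thesis by (simp add: \<sigma>_def \<tau>_def power2_eq_square algebra_simps)
    qed
    moreover have "1 + C * \<gamma> \<le> 2" using small(4) by simp
    moreover have "0 \<le> (k4 * \<gamma>\<^sup>2 * (q * q) + 2 * \<sigma> * \<tau> * (4 * \<gamma> * q)) * t"
      using t by (simp add: \<sigma>_def \<tau>_def)
    ultimately have "(1 + C * \<gamma>) * ((k4 * \<gamma>\<^sup>2 * (q * q) + 2 * \<sigma> * \<tau> * (4 * \<gamma> * q)) * t)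
        \<le> 2 * ((k4 * c0 + 8 * A\<^sup>2 * c1 * c0) * \<gamma> * \<epsilon> * (\<gamma> * q))"
      by - (rule mult_mono, assumption+, simp)
    then show ?thesis by (simp only: mult.assoc)
  qed
  also have "4 * (1400 * N\<^sup>2 * \<epsilon>) * \<tau> * (4 * \<gamma> * q) = 22400 * N\<^sup>2 * A * c1 * \<gamma> * \<epsilon> * (\<gamma> * q)"
    by (simp add: \<tau>_def)
  finally show "norm (snd (snd (y t))) \<le> (1 + C * \<gamma>) * exp (- \<kappa> * \<gamma> * \<epsilon> * t) * norm \<zeta>0 + k5 * \<gamma> * \<epsilon> * (\<gamma> * q)"
    by (simp add: \<zeta>_def init k5_eq algebra_simps)
qed

text \<open>The bounds in \<open>good\<close> improve themselves to strict ones.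
  \<open>\<Phi>\<close> is the largest ratio of a component to its allowed size, so that a single
  scalar function is bootstrapped.\<close>

lemma good_on_interval:
  assumes "t \<in> {0..T}"
  shows "good t"
proof -
  note nonneg [simp] = powers(1,2)[THEN less_imp_le] \<epsilon>_pos[THEN less_imp_le] \<gamma>_pos[THEN less_imp_le]
    const_pos[THEN less_imp_le] pos[THEN less_imp_le]
  define \<Phi> where "\<Phi> t = max (\<bar>fst (y t)\<bar> / \<gamma>)
    (max (\<bar>fst (snd (y t))\<bar> / (d0 * \<gamma> * u)) (norm (snd (snd (y t))) / (4 * \<gamma> * q)))" for t
  have denom: "0 < \<gamma>" "0 < d0 * \<gamma> * u" "0 < 4 * \<gamma> * q"
    using \<gamma>_pos const_pos(2) powers(1,2) by simp_all
  have good_iff: "good t \<longleftrightarrow> \<Phi> t \<le> 1" for t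
    using denom by (simp add: good_def \<Phi>_def pos_divide_le_eq)
  have "\<Phi> t < 1"
  proof (rule continuity_bootstrap[OF _ _ _ assms])
    show "continuous_on {0..T} \<Phi>"
      unfolding \<Phi>_def using denom
      by (intro continuous_intros continuous_on_vector_derivative[OF component_deriv(1)]
          continuous_on_vector_derivative[OF component_deriv(2)]
          continuous_on_vector_derivative[OF component_deriv(3)]) auto
    show "\<Phi> 0 < 1"
    proof -
      have "norm \<zeta>0 < 4 * \<gamma> * q" using init(2) denom(3) by linarith
      then show ?thesis using init(1) denom by (simp add: \<Phi>_def pos_divide_less_eq)
    qed
    fix t assume t: "t \<in> {0..T}" and "\<And>s. s \<in> {0..t} \<Longrightarrow> \<Phi> s \<le> 1"
    then have "\<forall>s\<in>{0..t}. good s" by (simp add: good_iff)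
    note b = bounds_while_good[OF t this]
    have t\<epsilon>: "t * \<epsilon> \<le> c0" using t T \<epsilon>_pos mult_right_mono[of t T \<epsilon>] by auto
    have qqt: "q * q * t \<le> u * \<epsilon> * c0"
      unfolding powers(5) using mult_left_mono[OF t\<epsilon>, of "u * \<epsilon>"] by (simp add: power2_eq_square mult_ac)
    have "u * \<epsilon> \<le> 1" using powers(10) \<epsilon>1 by (intro mult_le_one) auto
    then have "u * \<epsilon> * c0 \<le> 1 * c0" by (intro mult_right_mono) auto
    then have "q * q * t \<le> 1 * c0" using qqt by linarith
    then have "k1 * \<gamma>\<^sup>2 * (q * q * t) \<le> k1 * \<gamma>\<^sup>2 * c0" by (intro mult_left_mono) auto
    also have "\<dots> = \<gamma> * (k1 * c0 * \<gamma>)" by (simp add: power2_eq_square)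
    also have "\<dots> < \<gamma> * 1" using small(1) \<gamma>_pos by (intro mult_strict_left_mono) auto
    finally have s: "\<bar>fst (y t)\<bar> < \<gamma>" using b(1) by (simp only: mult.assoc mult_1_right)
    have "k2 * \<gamma>\<^sup>2 * (q * q * t) \<le> k2 * \<gamma>\<^sup>2 * (u * \<epsilon> * c0)" using qqt by (intro mult_left_mono) auto
    also have "\<dots> = (k2 * \<gamma>) * (\<gamma> * u * c0) * \<epsilon>" by (simp add: power2_eq_square)
    also have "\<dots> \<le> 1 * (\<gamma> * u * c0) * 1" using small(2) \<epsilon>1 by (intro mult_mono) auto
    finally have "\<bar>fst (snd (y t)) + 2 * \<gamma> * u * \<epsilon> * t\<bar> \<le> \<gamma> * u * c0" using b(2) by (simp only: mult.assoc)
    \<comment> \<open>In units of \<open>\<gamma> * u * c0\<close>, the drift takes at most 2 and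
      the error at most 1 of the 4 allowed by \<open>d0\<close>.\<close>
    moreover have "2 * \<gamma> * u * \<epsilon> * t \<le> 2 * (\<gamma> * u * c0)" "0 \<le> 2 * \<gamma> * u * \<epsilon> * t"
      using mult_left_mono[OF t\<epsilon>, of "2 * \<gamma> * u"] t by (simp_all add: mult_ac)
    moreover have "0 < \<gamma> * u * c0" using \<gamma>_pos powers(2) const_pos(1) by simp
    moreover have "d0 * \<gamma> * u = 4 * (\<gamma> * u * c0)" by (simp add: d0_eq)
    ultimately have \<delta>: "\<bar>fst (snd (y t))\<bar> < d0 * \<gamma> * u" by linarith
    \<comment> \<open>In units of \<open>\<gamma> * q\<close>, the initial value takes at most 3, by
      \<open>1 + C * \<gamma> \<le> 3/2\<close>, and the errors less than 1 of the 4
      allowed.\<close>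
    have "(1 + C * \<gamma>) * exp (- \<kappa> * \<gamma> * \<epsilon> * t) * norm \<zeta>0 \<le> (3/2) * 1 * (2 * \<gamma> * q)"
      using small(4) t init(2) by (intro mult_mono) auto
    moreover have "k5 * \<gamma> * \<epsilon> * (\<gamma> * q) < 1 * (\<gamma> * q)"
    proof (rule mult_strict_right_mono)
      have "k5 * \<gamma> * \<epsilon> \<le> k5 * \<gamma> * 1" using \<epsilon>1 by (intro mult_left_mono) auto
      then show "k5 * \<gamma> * \<epsilon> < 1" using small(5) by simp
    qed (use \<gamma>_pos powers(1) in simp)
    ultimately have "norm (snd (snd (y t))) < 4 * \<gamma> * q" using b(3) by simp
    with s \<delta> show "\<Phi> t < 1" using denom by (simp add: \<Phi>_def pos_divide_less_eq)
  qed
  then show ?thesis by (simp add: good_iff)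
qed

lemma trajectory_bounds:
  assumes t: "t \<in> {0..T}"
  shows "y t \<in> state_nbhd r \<epsilon> \<phi>"
    and "\<bar>fst (y t)\<bar> \<le> \<gamma>" "\<bar>fst (snd (y t))\<bar> \<le> d0 * \<gamma>" "norm (snd (snd (y t))) \<le> 4 * \<gamma> * q"
    and "\<bar>fst (snd (y t)) + 2 * \<gamma> * u * \<epsilon> * t\<bar> \<le> k2 * \<gamma>\<^sup>2 * (q * q) * t"
    and "norm (snd (snd (y t))) \<le> (1 + C * \<gamma>) * exp (- \<kappa> * \<gamma> * \<epsilon> * t) * norm \<zeta>0 + k5 * \<gamma> * \<epsilon> * (\<gamma> * q)"
proof -
  have "\<forall>s\<in>{0..t}. good s" using t good_on_interval by auto
  note b = bounds_while_good[OF t this]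
  have "d0 * \<gamma> * u \<le> d0 * \<gamma> * 1"
    using powers(10) const_pos(2) \<gamma>_pos by (intro mult_left_mono) auto
  then show "\<bar>fst (y t)\<bar> \<le> \<gamma>" "\<bar>fst (snd (y t))\<bar> \<le> d0 * \<gamma>" "norm (snd (snd (y t))) \<le> 4 * \<gamma> * q"
    using good_on_interval[OF t] by (auto simp: good_def)
  show "y t \<in> state_nbhd r \<epsilon> \<phi>" using good_nbhd[OF t good_on_interval[OF t]] .
  show "\<bar>fst (snd (y t)) + 2 * \<gamma> * u * \<epsilon> * t\<bar> \<le> k2 * \<gamma>\<^sup>2 * (q * q) * t"
    "norm (snd (snd (y t))) \<le> (1 + C * \<gamma>) * exp (- \<kappa> * \<gamma> * \<epsilon> * t) * norm \<zeta>0 + k5 * \<gamma> * \<epsilon> * (\<gamma> * q)"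
    using b(2,3) by blast+
qed

end

end

section \<open>Existence and conclusion\<close>

context damped_system
begin

lemma state_nbhd_eq: "state_nbhd r \<epsilon> \<phi> = cball 0 r \<times> cball 0 r \<times> (cball 0 r \<inter> range P)"
  by (auto simp: state_nbhd_def)

lemma state_nbhd_closed_convex:
  "closed (state_nbhd r \<epsilon> \<phi> :: 'n state set)" "convex (state_nbhd r \<epsilon> \<phi> :: 'n state set)"
  using closed_subspace[OF subspace_range_P] subspace_imp_convex[OF subspace_range_P]
  by (auto simp: state_nbhd_eq intro!: closed_Times convex_Times convex_Int closed_Int)

lemma F_range:
  assumes "y \<in> state_nbhd r \<epsilon> \<phi>"
  shows "snd (snd (F y)) \<in> range P"
  using F[unfolded modulation_system_def, THEN conjunct2, THEN bspec, OF assms]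
  by (cases y) auto

lemma evolution_exists:
  assumes \<zeta>0: "\<zeta>0 \<in> range P" "norm \<zeta>0 \<le> 2 * \<gamma> * q"
  shows "\<exists>y. evolves \<epsilon> \<phi> F T (0, 0, \<zeta>0) y"
proof -
  define S where "S = (state_nbhd r \<epsilon> \<phi> :: 'n state set)"
  have "(0, 0, 0) \<in> S"
    using state_nbhdI[of 0 0 0] subspace_0[OF subspace_range_P] \<gamma>_pos const_pos(2) powers by (simp add: S_def)
  then have S: "closed S" "convex S" "S \<noteq> {}"
    using state_nbhd_closed_convex by (auto simp: S_def)
  \<comment> \<open>The field agrees with \<open>F\<close> on \<open>S\<close> and is globally Lipschitz, so that Picard iteration applies;
    the a priori bounds keep the solution in \<open>S\<close>.\<close>
  define G where "G y = F (closest_point S y)" for y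
  obtain M where M: "M-lipschitz_on S F" using F by (auto simp: modulation_system_def S_def)
  have lip: "norm (G v - G w) \<le> (M + 1) * norm (v - w)" for v w
  proof -
    have "dist (G v) (G w) \<le> M * dist (closest_point S v) (closest_point S w)"
      unfolding G_def using closest_point_in_set[OF S(1,3)] by (intro lipschitz_onD[OF M])
    also have "\<dots> \<le> (M + 1) * dist v w"
      using closest_point_lipschitz[OF S(2,1,3), of v w] lipschitz_on_nonneg[OF M] by (intro mult_mono) auto
    finally show ?thesis by (simp add: dist_norm)
  qed
  \<comment> \<open>\<open>picard_exists\<close> asks for a positive Lipschitz constant, and
    \<open>M\<close> may be 0.\<close>
  have M0: "0 < M + 1" using lipschitz_on_nonneg[OF M] by simp
  have "(M + 1)-lipschitz_on UNIV G"
    using lip M0 by (intro lipschitz_onI) (auto simp: dist_norm)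
  then have cont: "continuous_on UNIV G" by (rule lipschitz_on_continuous_on)
  obtain y where y: "y 0 = (0, 0, \<zeta>0)"
    "\<And>t. t \<in> {0..T} \<Longrightarrow> (y has_vector_derivative G (y t)) (at t within {0..T})"
  proof (rule picard_exists[of T "M + 1" "\<lambda>_. G" "(0, 0, \<zeta>0)"])
    show "continuous_on {0..T} (\<lambda>s. G (v s))" if "continuous_on {0..T} v" for v
      by (rule continuous_on_compose2[OF cont that]) simp
  qed (use T(1) M0 lip in auto)
  have deriv: "((\<lambda>t. snd (snd (y t))) has_vector_derivative snd (snd (G (y t)))) (at t within {0..T})"
    if "t \<in> {0..T}" for t
    using bounded_linear.has_vector_derivative[OF bounded_linear_snd
        bounded_linear.has_vector_derivative[OF bounded_linear_snd y(2)[OF that]]] .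
  \<comment> \<open>\<open>closest_point S\<close> takes values in \<open>S\<close>, so the last
    component of \<open>G\<close> lies in the range of \<open>P\<close> even before \<open>y\<close>
    is known to stay in \<open>S\<close>.\<close>
  have range: "snd (snd (y t)) \<in> range P" if "t \<in> {0..T}" for t
  proof (rule range_P_invariant[OF _ deriv _ that])
    show "snd (snd (y 0)) \<in> range P" using \<zeta>0(1) by (simp add: y(1))
    show "snd (snd (G (y t))) \<in> range P" for t
      unfolding G_def using closest_point_in_set[OF S(1,3)] by (intro F_range) (simp add: S_def)
  qed
  have G_eq: "G (y t) = F (y t)" if "y t \<in> state_nbhd r \<epsilon> \<phi>" for t
    using that by (simp add: G_def closest_point_self S_def)
  have "y t \<in> state_nbhd r \<epsilon> \<phi>" if "t \<in> {0..T}" for t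
    using trajectory_bounds(1)[OF y(1) \<zeta>0(2) range y(2) G_eq that] .
  then show ?thesis
    unfolding evolves_def using y range G_eq by (intro exI[of _ y]) simp
qed

end

section \<open>Pointwise meaning of \<open>tnorm\<close>, and two inequalities for
  exponentials\<close>

lemma tnorm_0_le:
  assumes "tnorm \<epsilon> \<gamma> 0 (x :: real \<Rightarrow> 'n::{finite,linorder} state) \<le> ereal c" "0 < \<gamma> * \<epsilon> ^ CARD('n)"
  shows "norm (snd (snd (x 0))) \<le> c * (\<gamma> * \<epsilon> ^ CARD('n))"
proof -
  have "ereal (inverse (\<gamma> * \<epsilon> ^ CARD('n))) * ereal (norm (snd (snd (x 0)))) \<le> ereal c"
    using assms(1) by (simp add: tnorm_def)
  then show ?thesis using assms(2) by (simp add: field_simps)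
qed

lemma tnorm_le:
  fixes x :: "real \<Rightarrow> 'n::{finite,linorder} state"
  assumes "\<And>\<tau>. \<tau> \<in> {0..t} \<Longrightarrow> \<bar>fst (x \<tau>)\<bar> \<le> c" "\<And>\<tau>. \<tau> \<in> {0..t} \<Longrightarrow> \<bar>fst (snd (x \<tau>))\<bar> \<le> c"
    and "\<And>\<tau>. \<tau> \<in> {0..t} \<Longrightarrow> norm (snd (snd (x \<tau>))) \<le> c * (\<gamma> * \<epsilon> ^ CARD('n))"
    and pos: "0 < \<gamma> * \<epsilon> ^ CARD('n)"
  shows "tnorm \<epsilon> \<gamma> t x \<le> ereal c"
proof -
  define m where "m = \<gamma> * \<epsilon> ^ CARD('n)"
  have m: "0 < m" using pos by (simp add: m_def)
  have "(SUP \<tau>\<in>{0..t}. ereal (norm (snd (snd (x \<tau>))))) \<le> ereal (c * m)"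
    using assms(3) by (intro SUP_least) (auto simp: m_def)
  then have "ereal (inverse m) * (SUP \<tau>\<in>{0..t}. ereal (norm (snd (snd (x \<tau>)))))
      \<le> ereal (inverse m) * ereal (c * m)"
    by (rule ereal_mult_left_mono) (use m in simp)
  also have "\<dots> = ereal c" using m by simp
  finally show ?thesis
    unfolding tnorm_def m_def[symmetric] using assms(1,2) by (auto intro!: SUP_least)
qed

text \<open>Used with \<open>a = C * \<gamma>\<close>, where \<open>8 * a\<close> is the total decay
  exponent at time \<open>T\<close>. The additive error \<open>a\<close> is paid for by weakening
  \<open>exp (- 8 * a)\<close> to \<open>exp (- 6 * a)\<close>: this gains a factor of at least
  \<open>1 + 2 * a\<close>, and \<open>exp (- 8 * a)\<close> is still at least 1/2.\<close>

lemma exp_slack: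
  fixes a :: real
  assumes "0 \<le> a" "16 * a \<le> 1"
  shows "exp (- 8 * a) * (1 + a) + a \<le> exp (- 6 * a) * (1 + 3 / 2 * a)"
proof -
  have half: "1/2 \<le> exp (- 8 * a)" using exp_ge_add_one_self[of "- 8 * a"] assms by simp
  have "1 + 2 * a \<le> exp (2 * a)" using exp_ge_add_one_self[of "2 * a"] by simp
  then have "(1 + 2 * a) * (1 + 3 / 2 * a) \<le> exp (2 * a) * (1 + 3 / 2 * a)"
    using assms by (intro mult_right_mono) auto
  moreover have "(1 + 2 * a) * (1 + 3 / 2 * a) = 1 + 7 / 2 * a + 3 * (a * a)"
    by (simp add: algebra_simps add_divide_distrib)
  ultimately have "2 * a \<le> exp (2 * a) * (1 + 3 / 2 * a) - (1 + a)"
    using assms(1) zero_le_square[of a] by linarith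
  with half have "1/2 * (2 * a) \<le> exp (- 8 * a) * (exp (2 * a) * (1 + 3 / 2 * a) - (1 + a))"
    using assms by (intro mult_mono) auto
  moreover have "exp (- 8 * a) * exp (2 * a) = exp (- 6 * a)" by (simp flip: exp_add)
  then have "exp (- 8 * a) * (exp (2 * a) * (1 + 3 / 2 * a)) = exp (- 6 * a) * (1 + 3 / 2 * a)"
    by (metis mult.assoc)
  ultimately show ?thesis by (simp add: algebra_simps)
qed

text \<open>The exponential majorises \<open>1 + 3 / 2 * a\<close>, leaving
  \<open>exp (- 5 / 2 * a)\<close>, which is at most \<open>1 - a\<close> and so at most
  \<open>1 - b\<close>.\<close>

lemma exp_absorbs_prefactor:
  fixes a b :: real
  assumes "0 \<le> a" "8 * a \<le> 1" "b \<le> a" "0 \<le> b"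
  shows "exp (- 4 * a) * inverse (1 - b) * (1 + 3 / 2 * a) \<le> 1"
proof -
  have "exp (- 4 * a) * (1 + 3 / 2 * a) \<le> exp (- 4 * a) * exp (3 / 2 * a)"
    using exp_ge_add_one_self[of "3 / 2 * a"] by (intro mult_left_mono) auto
  also have "\<dots> = inverse (exp (5 / 2 * a))" by (simp flip: exp_add exp_minus)
  also have "\<dots> \<le> inverse (1 + 5 / 2 * a)"
    using exp_ge_add_one_self[of "5 / 2 * a"] assms by (intro le_imp_inverse_le) auto
  also have "\<dots> \<le> 1 - a"
  proof -
    have "a * (8 * a) \<le> a * 1" using assms by (intro mult_left_mono) auto
    then have "1 \<le> (1 - a) * (1 + 5 / 2 * a)" using assms by (simp add: algebra_simps)
    then show ?thesis using assms by (simp add: field_simps)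
  qed
  also have "\<dots> \<le> 1 - b" using assms by simp
  finally show ?thesis using assms by (simp add: field_simps)
qed

theorem theorem8p2:
  fixes C \<kappa> K r :: real
  assumes "CARD('n::{finite,linorder}) \<ge> 2"
    and "C > 0" and "\<kappa> > 0" and "K > 0" and "r > 0"
  shows "\<exists>\<rho>>0. \<forall>\<epsilon> \<gamma> \<phi>0 T. 0 < \<epsilon> \<and> \<epsilon> < \<rho> \<and> 0 < \<gamma> \<and> \<gamma> < \<rho> \<and> \<bar>\<phi>0\<bar> < \<rho> \<and>
    T = 8 * C / (\<kappa> * \<epsilon>) \<and>
    (\<forall>t\<in>{0..T}. \<forall>\<zeta>\<in>range (P_op \<epsilon> \<phi>0 :: 'n phase \<Rightarrow> 'n phase).
      norm (semigroup_L \<epsilon> \<gamma> \<phi>0 t \<zeta>) \<le> (1 + C * \<gamma>) * exp (- \<kappa> * \<gamma> * \<epsilon> * t) * norm \<zeta>) \<longrightarrow>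
    (\<forall>(F :: 'n state \<Rightarrow> 'n state) (x :: real \<Rightarrow> 'n state).
      modulation_system K r \<epsilon> \<gamma> \<phi>0 F \<and>
      tnorm \<epsilon> \<gamma> T x \<le> 2 \<and> tnorm \<epsilon> \<gamma> 0 x \<le> 2 \<and>
      fst (x 0) = 0 \<and> fst (snd (x 0)) = 0 \<and> snd (snd (x 0)) \<in> range (P_op \<epsilon> \<phi>0) \<longrightarrow>
      (\<exists>y. evolves \<epsilon> \<phi>0 F T (x 0) y) \<and>
      (\<forall>y. evolves \<epsilon> \<phi>0 F T (x 0) y \<longrightarrow>
        (\<forall>t\<in>{0..T}. tnorm \<epsilon> \<gamma> t y \<le> 4) \<and>
        (tnorm \<epsilon> \<gamma> 0 x \<le> 1 \<longrightarrow>
          \<bar>fst (snd (y T)) + 2 * \<gamma> * \<epsilon> ^ (2 * CARD('n) - 1) * T\<bar>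
            \<le> 2 * \<gamma> * \<epsilon> powr (2 * real CARD('n) - 1 / 2) * T \<and>
          norm (snd (snd (y T)))
            \<le> exp (- \<kappa> * \<gamma> * \<epsilon> * T / 4) * exp (- \<kappa> * \<gamma> * \<epsilon> * T / 2) * inverse (1 - \<gamma> * \<epsilon>)
                * (1 + 3 / 2 * C * \<gamma>) * (\<gamma> * \<epsilon> ^ CARD('n)) \<and>
          exp (- \<kappa> * \<gamma> * \<epsilon> * T / 4) * exp (- \<kappa> * \<gamma> * \<epsilon> * T / 2) * inverse (1 - \<gamma> * \<epsilon>)
                * (1 + 3 / 2 * C * \<gamma>) * (\<gamma> * \<epsilon> ^ CARD('n))
            \<le> exp (- \<kappa> * \<gamma> * \<epsilon> * T / 4) * (\<gamma> * \<epsilon> ^ CARD('n)))))"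
proof -
  define N where "N = real CARD('n)"
  define c0 where "c0 = 8 * C / \<kappa>"
  define d0 where "d0 = 4 * c0"
  define k1 where "k1 = K * (4 * d0 + 20)"
  define k2 where "k2 = K * d0 + k1"
  define k3 where "k3 = k1 * K * (d0 + 1) + (2 + k2) * K * d0 + 16 * K"
  define k4 where "k4 = 6000 * N\<^sup>2 * k3"
  define A where "A = 600000 * N ^ 3"
  define c1 where "c1 = c0\<^sup>2 + 2 * c0"
  define k5 where "k5 = 2 * (k4 * c0 + 8 * A\<^sup>2 * c1 * c0) + 22400 * N\<^sup>2 * A * c1"
  note defs = c0_def d0_def k1_def k2_def k3_def k4_def A_def c1_def k5_def
  \<comment> \<open>Every smallness requirement reads \<open>c * \<xi> < 1\<close> with
    \<open>c\<close> in this finite set and \<open>\<xi>\<close> one of the small parameters, so the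
    reciprocal of the maximum is a threshold depending only on \<open>n\<close>, \<open>C\<close>,
    \<open>\<kappa>\<close>, \<open>K\<close> and \<open>r\<close>. The quotients by
    \<open>r\<close> keep states in the neighbourhood; \<open>k5 / C\<close> and
    \<open>1 / C\<close> ensure \<open>k5 * \<epsilon> \<le> C\<close> and
    \<open>\<epsilon> \<le> C\<close>.\<close>
  define cs where "cs = {1, 200 * N, k1 * c0, k2, 16 * N * A * c1, 16 * C, k5, k5 / C, 1 / C, 1 / r, d0 / r, 4 / r, d0}"
  have cs: "1 \<in> cs" "200 * N \<in> cs" "k1 * c0 \<in> cs" "k2 \<in> cs" "16 * N * A * c1 \<in> cs" "16 * C \<in> cs" "k5 \<in> cs" "k5 / C \<in> cs" "1 / C \<in> cs" "1 / r \<in> cs" "d0 / r \<in> cs" "4 / r \<in> cs" "d0 \<in> cs"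
    by (simp_all only: cs_def insert_iff simp_thms)
  define \<Lambda> where "\<Lambda> = Max cs"
  have \<Lambda>: "c \<le> \<Lambda>" if "c \<in> cs" for c unfolding \<Lambda>_def by (intro Max_ge that) (simp add: cs_def)
  have \<Lambda>_pos: "0 < \<Lambda>" using \<Lambda>[OF cs(1)] by simp
  have small: "c * \<xi> < 1" if "c \<in> cs" "0 \<le> \<xi>" "\<xi> < 1 / \<Lambda>" for c \<xi> :: real
  proof -
    have "c * \<xi> \<le> \<Lambda> * \<xi>" using \<Lambda>[OF that(1)] that(2) by (rule mult_right_mono)
    also have "\<dots> < 1" using that(3) \<Lambda>_pos by (simp add: field_simps)
    finally show ?thesis .
  qed
  show ?thesis
  proof (intro exI[of _ "1 / \<Lambda>"] conjI allI impI; (elim conjE)?)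
    show "0 < 1 / \<Lambda>" using \<Lambda>_pos by simp
  next
    fix \<epsilon> \<gamma> \<phi>0 T and F :: "'n state \<Rightarrow> 'n state" and x :: "real \<Rightarrow> 'n state"
    assume \<epsilon>: "0 < \<epsilon>" "\<epsilon> < 1 / \<Lambda>" and \<gamma>: "0 < \<gamma>" "\<gamma> < 1 / \<Lambda>" and \<phi>0: "\<bar>\<phi>0\<bar> < 1 / \<Lambda>"
      and T_eq: "T = 8 * C / (\<kappa> * \<epsilon>)"
      and semigroup: "\<forall>t\<in>{0..T}. \<forall>\<zeta>\<in>range (P_op \<epsilon> \<phi>0 :: 'n phase \<Rightarrow> 'n phase).
        norm (semigroup_L \<epsilon> \<gamma> \<phi>0 t \<zeta>) \<le> (1 + C * \<gamma>) * exp (- \<kappa> * \<gamma> * \<epsilon> * t) * norm \<zeta>"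
      and F: "modulation_system K r \<epsilon> \<gamma> \<phi>0 F"
      and x: "tnorm \<epsilon> \<gamma> 0 x \<le> 2" "fst (x 0) = 0" "fst (snd (x 0)) = 0" "snd (snd (x 0)) \<in> range (P_op \<epsilon> \<phi>0)"
    have sm: "c * \<epsilon> < 1" "c * \<gamma> < 1" "c * \<bar>\<phi>0\<bar> < 1" if "c \<in> cs" for c
      using small[OF that] \<epsilon> \<gamma> \<phi>0 by auto
    interpret damped_system \<epsilon> \<phi>0 "breather \<epsilon> \<phi>0 :: 'n rvec" "B_inv_p \<epsilon> \<phi>0" N \<gamma> C \<kappa> K r T F
      c0 d0 k1 k2 k3 k4 k5 A c1
    proof (unfold_locales)
      show "200 * N * \<epsilon> < 1" "200 * N * \<bar>\<phi>0\<bar> < 1" using sm(1,3)[OF cs(2)] by auto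
      show "\<epsilon> \<le> 1" "\<gamma> \<le> 1" using sm(1,2)[OF cs(1)] by auto
      show "k1 * c0 * \<gamma> < 1" "k2 * \<gamma> < 1" "16 * N * A * c1 * \<gamma> < 1" "k5 * \<gamma> < 1"
        by (rule sm(2)[OF cs(3)] sm(2)[OF cs(4)] sm(2)[OF cs(5)] sm(2)[OF cs(7)])+
      have "16 * C * \<gamma> < 1" by (rule sm(2)[OF cs(6)])
      then show "2 * C * \<gamma> < 1" using \<open>0 < C\<close> \<gamma>(1) mult_pos_pos[of C \<gamma>] by linarith
      show "\<gamma> \<le> r" "d0 * \<gamma> \<le> r" "4 * \<gamma> \<le> r"
        using sm(2)[OF cs(10)] sm(2)[OF cs(11)] sm(2)[OF cs(12)] \<open>0 < r\<close> by (auto simp: field_simps)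
    qed (rule assms \<epsilon>(1) \<gamma>(1) T_eq F semigroup[rule_format] N_def defs refl | assumption)+
    define \<zeta>0 where "\<zeta>0 = snd (snd (x 0))"
    have x0: "x 0 = (0, 0, \<zeta>0)" using x(2,3) by (simp add: \<zeta>0_def prod_eq_iff)
    have \<mu>: "0 < \<gamma> * \<epsilon> ^ CARD('n)" using \<gamma>(1) \<epsilon>(1) by simp
    have \<zeta>0: "norm \<zeta>0 \<le> 2 * \<gamma> * q"
      using tnorm_0_le[of \<epsilon> \<gamma> x 2] x(1) \<mu> by (simp add: \<zeta>0_def q_def)
    have c\<gamma>: "16 * (C * \<gamma>) \<le> 1"
      using sm(2)[OF cs(6)] by simp
    show "\<exists>y. evolves \<epsilon> \<phi>0 F T (x 0) y"
      unfolding x0 using x(4) \<zeta>0 by (intro evolution_exists) (simp_all add: \<zeta>0_def)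
    fix y assume "evolves \<epsilon> \<phi>0 F T (x 0) y"
    then have y: "y 0 = (0, 0, \<zeta>0)" "\<And>t. t \<in> {0..T} \<Longrightarrow> snd (snd (y t)) \<in> range P"
      "\<And>t. t \<in> {0..T} \<Longrightarrow> (y has_vector_derivative F (y t)) (at t within {0..T})"
      by (auto simp: evolves_def x0)
    have bounds: "\<bar>fst (y t)\<bar> \<le> \<gamma>" "\<bar>fst (snd (y t))\<bar> \<le> d0 * \<gamma>" "norm (snd (snd (y t))) \<le> 4 * \<gamma> * q"
      "\<bar>fst (snd (y t)) + 2 * \<gamma> * u * \<epsilon> * t\<bar> \<le> k2 * \<gamma>\<^sup>2 * (q * q) * t"
      "norm (snd (snd (y t))) \<le> (1 + C * \<gamma>) * exp (- \<kappa> * \<gamma> * \<epsilon> * t) * norm \<zeta>0 + k5 * \<gamma> * \<epsilon> * (\<gamma> * q)"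
      if "t \<in> {0..T}" for t
      using trajectory_bounds(2-6)[OF y(1) \<zeta>0 y(2,3) refl that] by blast+
    show "\<forall>t\<in>{0..T}. tnorm \<epsilon> \<gamma> t y \<le> 4"
    proof
      fix t assume t: "t \<in> {0..T}"
      have "\<gamma> \<le> 4" using \<gamma>1 by simp
      moreover have "d0 * \<gamma> < 1" by (rule sm(2)[OF cs(13)])
      ultimately show "tnorm \<epsilon> \<gamma> t y \<le> 4"
        using tnorm_le[of t y 4 \<gamma> \<epsilon>] bounds(1-3) t \<mu> by (force simp: q_def)
    qed
    assume "tnorm \<epsilon> \<gamma> 0 x \<le> 1"
    then have \<zeta>0': "norm \<zeta>0 \<le> \<gamma> * q"
      using tnorm_0_le[of \<epsilon> \<gamma> x 1] \<mu> by (simp add: \<zeta>0_def q_def one_ereal_def)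
    have TT: "T \<in> {0..T}" using T by simp
    show "\<bar>fst (snd (y T)) + 2 * \<gamma> * \<epsilon> ^ (2 * CARD('n) - 1) * T\<bar>
        \<le> 2 * \<gamma> * \<epsilon> powr (2 * real CARD('n) - 1 / 2) * T"
    proof -
      define h where "h = \<epsilon> powr (2 * real CARD('n) - 1 / 2)"
      have h: "0 \<le> h" by (simp add: h_def)
      \<comment> \<open>The drift error carries \<open>\<epsilon>\<close> to the power
        \<open>2n\<close>, half a power better than the bound claimed.\<close>
      have "h * \<epsilon> powr (1 / 2) = \<epsilon> powr real (2 * CARD('n))"
        unfolding h_def by (simp flip: powr_add)
      also have "\<dots> = \<epsilon> ^ (2 * CARD('n))" by (rule powr_realpow[OF \<epsilon>(1)])
      also have "\<dots> = q * q" by (simp only: q_def power_add[symmetric] mult_2)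
      finally have h_sqrt: "q * q = h * sqrt \<epsilon>" using \<epsilon>(1) by (simp add: powr_half_sqrt)
      have "\<bar>fst (snd (y T)) + 2 * \<gamma> * \<epsilon> ^ (2 * CARD('n) - 1) * T\<bar> \<le> k2 * \<gamma>\<^sup>2 * (q * q) * T"
        using bounds(4)[OF TT] unfolding powers(6) by (simp only: mult.assoc)
      also have "\<dots> = (\<gamma> * h * T) * (k2 * \<gamma> * sqrt \<epsilon>)"
        unfolding h_sqrt by (simp add: power2_eq_square)
      also have "\<dots> \<le> (\<gamma> * h * T) * 2"
      proof (rule mult_left_mono)
        have "k2 * \<gamma> * sqrt \<epsilon> \<le> 1 * 1"
          using sm(2)[OF cs(4)] \<epsilon>1 \<epsilon>(1) by (intro mult_mono) auto
        then show "k2 * \<gamma> * sqrt \<epsilon> \<le> 2" by simp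
      qed (use \<gamma>(1) T h in auto)
      finally show ?thesis by (simp add: h_def)
    qed
    \<comment> \<open>By the choice of \<open>T\<close> all exponents become multiples of
      \<open>C * \<gamma>\<close>.\<close>
    have \<kappa>T: "\<kappa> * \<gamma> * \<epsilon> * T = 8 * (C * \<gamma>)" using \<epsilon>(1) \<open>0 < \<kappa>\<close> by (simp add: T_eq)
    have e: "exp (- \<kappa> * \<gamma> * \<epsilon> * T) = exp (- 8 * (C * \<gamma>))"
      "exp (- \<kappa> * \<gamma> * \<epsilon> * T / 4) = exp (- 2 * (C * \<gamma>))"
      "exp (- \<kappa> * \<gamma> * \<epsilon> * T / 2) = exp (- 4 * (C * \<gamma>))"
      using \<kappa>T by simp_all
    have \<gamma>\<epsilon>: "0 \<le> \<gamma> * \<epsilon>" "\<gamma> * \<epsilon> \<le> C * \<gamma>" "\<gamma> * \<epsilon> < 1"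
    proof -
      show "0 \<le> \<gamma> * \<epsilon>" using \<gamma>(1) \<epsilon>(1) by simp
      have "\<epsilon> \<le> C" using sm(1)[OF cs(9)] \<open>0 < C\<close> by (simp add: field_simps)
      then show "\<gamma> * \<epsilon> \<le> C * \<gamma>" using \<gamma>(1) by simp
      then show "\<gamma> * \<epsilon> < 1" using c\<gamma> \<open>0 \<le> \<gamma> * \<epsilon>\<close> by linarith
    qed
    show "norm (snd (snd (y T)))
        \<le> exp (- \<kappa> * \<gamma> * \<epsilon> * T / 4) * exp (- \<kappa> * \<gamma> * \<epsilon> * T / 2) * inverse (1 - \<gamma> * \<epsilon>)
            * (1 + 3 / 2 * C * \<gamma>) * (\<gamma> * \<epsilon> ^ CARD('n))"
    proof -
      have "(1 + C * \<gamma>) * exp (- 8 * (C * \<gamma>)) * norm \<zeta>0 \<le> (1 + C * \<gamma>) * exp (- 8 * (C * \<gamma>)) * (\<gamma> * q)"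
        using \<zeta>0' \<open>0 < C\<close> \<gamma>(1) by (intro mult_left_mono) auto
      \<comment> \<open>The accumulated error becomes the additive term \<open>a\<close> of
        \<open>exp_slack\<close>, one factor \<open>\<epsilon>\<close> paying for the
        constant.\<close>
      moreover have "k5 * \<gamma> * \<epsilon> * (\<gamma> * q) \<le> C * \<gamma> * (\<gamma> * q)"
      proof (rule mult_right_mono)
        have "k5 * \<epsilon> \<le> C" using sm(1)[OF cs(8)] \<open>0 < C\<close> by (simp add: field_simps)
        then have "k5 * \<epsilon> * \<gamma> \<le> C * \<gamma>" using \<gamma>(1) by (intro mult_right_mono) auto
        then show "k5 * \<gamma> * \<epsilon> \<le> C * \<gamma>" by (simp add: mult_ac)
      qed (use \<gamma>(1) powers in auto)
      ultimately have "norm (snd (snd (y T))) \<le> (exp (- 8 * (C * \<gamma>)) * (1 + C * \<gamma>) + C * \<gamma>) * (\<gamma> * q)"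
        using bounds(5)[OF TT] unfolding e by (simp add: algebra_simps)
      also have "\<dots> \<le> (exp (- 6 * (C * \<gamma>)) * (1 + 3 / 2 * (C * \<gamma>))) * (\<gamma> * q)"
        using c\<gamma> \<open>0 < C\<close> \<gamma>(1) powers by (intro mult_right_mono exp_slack) auto
      \<comment> \<open>The factor is at least 1; inserting it brings the estimate to the stated
        form.\<close>
      also have "\<dots> \<le> inverse (1 - \<gamma> * \<epsilon>) * ((exp (- 6 * (C * \<gamma>)) * (1 + 3 / 2 * (C * \<gamma>))) * (\<gamma> * q))"
      proof -
        have "1 \<le> inverse (1 - \<gamma> * \<epsilon>)" using \<gamma>\<epsilon> by (simp add: one_le_inverse_iff)
        from mult_right_mono[OF this, of "(exp (- 6 * (C * \<gamma>)) * (1 + 3 / 2 * (C * \<gamma>))) * (\<gamma> * q)"]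
        show ?thesis using \<open>0 < C\<close> \<gamma>(1) powers by simp
      qed
      also have "exp (- 6 * (C * \<gamma>)) = exp (- 2 * (C * \<gamma>)) * exp (- 4 * (C * \<gamma>))"
        by (simp flip: exp_add)
      finally show ?thesis unfolding e by (simp add: q_def mult_ac)
    qed
    show "exp (- \<kappa> * \<gamma> * \<epsilon> * T / 4) * exp (- \<kappa> * \<gamma> * \<epsilon> * T / 2) * inverse (1 - \<gamma> * \<epsilon>)
          * (1 + 3 / 2 * C * \<gamma>) * (\<gamma> * \<epsilon> ^ CARD('n))
        \<le> exp (- \<kappa> * \<gamma> * \<epsilon> * T / 4) * (\<gamma> * \<epsilon> ^ CARD('n))"
    proof -
      have "exp (- 4 * (C * \<gamma>)) * inverse (1 - \<gamma> * \<epsilon>) * (1 + 3 / 2 * (C * \<gamma>)) \<le> 1"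
        using c\<gamma> \<gamma>\<epsilon> \<open>0 < C\<close> \<gamma>(1) by (intro exp_absorbs_prefactor) auto
      then have "(exp (- 2 * (C * \<gamma>)) * (\<gamma> * \<epsilon> ^ CARD('n)))
          * (exp (- 4 * (C * \<gamma>)) * inverse (1 - \<gamma> * \<epsilon>) * (1 + 3 / 2 * (C * \<gamma>)))
          \<le> (exp (- 2 * (C * \<gamma>)) * (\<gamma> * \<epsilon> ^ CARD('n))) * 1"
        using \<mu> by (intro mult_left_mono) auto
      then show ?thesis unfolding e by (simp add: mult_ac)
    qed
  qed
qed

end
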